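(* There is an isomorphism of real semi-algebraic sets $\beta:\mathcal{O}^{\mathrm{mult}}\to\mathcal{P}$. Moreover $\beta$ is such that, for $(A,B,C)\in\mathcal{O}^{\mathrm{mult}}$, if $F=\delta(\beta(A,B,C))$, then the singular values of $A$, $B$ and $C$ are the positive square roots of the zeros of $F(-1,u,0)$, $F(0,-1,u)$ and $F(u,0,-1)$ (as polynomials in $u$) respectively.
   Context: Fix $n\ge1$. $\mathcal{O}^{\mathrm{mult}}$ is the set of triples $(A,B,C)$ of invertible complex $n\times n$ matrices with $ABC=1$, modulo the action of $U_n^3$ (with $U_n$ the unitary group) given by $(U,V,W):(A,B,C)\mapsto(W^{-1}AU,\,U^{-1}BV,\,V^{-1}CW)$. The singular values of a matrix $A$ are the positive square roots of the eigenvalues of $A^*A$, where $A^*$ is the conjugate transpose. $\mathcal{P}$ is the set of triples $(X,Y,Z)$ of positive definite Hermitian complex $n\times n$ matrices modulo the action of $\mathrm{GL}_n(\mathbb{C})$ given by $G:(X,Y,Z)\mapsto(G^*XG,\,G^*YG,\,G^*ZG)$. The map $\delta$ sends the class of $(X,Y,Z)\in\mathcal{P}$ to the class of the homogeneous degree $n$ polynomial $\det(xX+yY+zZ)$ in $\mathbb{R}[x,y,z]_n/\mathbb{R}^\times$ (polynomials up to nonzero real scalars). *)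

theory Defs
  imports
    "HOL-Analysis.Analysis"
    "HOL-Computational_Algebra.Polynomial"
begin

section \<open>Semialgebraic sets and quotients\<close>

inductive semialgebraic :: "'a::euclidean_space set \<Rightarrow> bool" where
  pos: "real_polynomial_function p \<Longrightarrow> semialgebraic {x. 0 < p x}"
| compl: "semialgebraic S \<Longrightarrow> semialgebraic (- S)"
| un: "semialgebraic S \<Longrightarrow> semialgebraic T \<Longrightarrow> semialgebraic (S \<union> T)"

definition quotient_topology :: "'a topology \<Rightarrow> ('a \<times> 'a) set \<Rightarrow> 'a set topology" where
  "quotient_topology X r =
     topology (\<lambda>U. U \<subseteq> topspace X // r \<and> openin X {x \<in> topspace X. r `` {x} \<in> U})"

lemma openin_quotient_topology:
  "openin (quotient_topology X r) U \<longleftrightarrow>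
     U \<subseteq> topspace X // r \<and> openin X {x \<in> topspace X. r `` {x} \<in> U}"
proof -
  let ?L = "\<lambda>U. U \<subseteq> topspace X // r \<and> openin X {x \<in> topspace X. r `` {x} \<in> U}"
  have "istopology ?L"
    unfolding istopology_def
  proof (intro conjI allI impI)
    fix S T assume ST: "?L S" "?L T"
    then show "S \<inter> T \<subseteq> topspace X // r" by blast
    have "{x \<in> topspace X. r `` {x} \<in> S \<inter> T} =
      {x \<in> topspace X. r `` {x} \<in> S} \<inter> {x \<in> topspace X. r `` {x} \<in> T}" by blast
    then show "openin X {x \<in> topspace X. r `` {x} \<in> S \<inter> T}" using ST by auto
  next
    fix K assume K: "\<forall>S\<in>K. ?L S"
    then show "\<Union> K \<subseteq> topspace X // r" by blast
    have "{x \<in> topspace X. r `` {x} \<in> \<Union> K} = (\<Union>S\<in>K. {x \<in> topspace X. r `` {x} \<in> S})"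
      by blast
    then show "openin X {x \<in> topspace X. r `` {x} \<in> \<Union> K}" using K by auto
  qed
  then show ?thesis by (simp add: quotient_topology_def)
qed

lemma topspace_quotient_topology: "topspace (quotient_topology X r) = topspace X // r"
proof -
  have "openin (quotient_topology X r) (topspace X // r)"
    by (auto simp: openin_quotient_topology quotientI cong: conj_cong)
  then show ?thesis
    by (metis openin_quotient_topology openin_subset openin_topspace subset_antisym)
qed

lemma quotient_map_quotient_topology:
  "quotient_map X (quotient_topology X r) (\<lambda>x. r `` {x})"
  by (auto simp: quotient_map_def topspace_quotient_topology openin_quotient_topology quotient_def)

text \<open>
  The quotient \<open>M // r\<close> of a semialgebraic set by a semialgebraic equivalence relation carries the
  quotient topology, and a subset of it (or of a product of such quotients) is semialgebraic iff its
  preimage upstairs is. An isomorphism is a semialgebraic homeomorphism, that is, a homeomorphism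
  whose graph is semialgebraic; the last conjunct spells out the preimage of the graph in \<open>M \<times> N\<close>.
\<close>
definition semialgebraic_quotient_iso ::
  "'a::euclidean_space set \<Rightarrow> ('a \<times> 'a) set \<Rightarrow> 'b::euclidean_space set \<Rightarrow> ('b \<times> 'b) set
     \<Rightarrow> ('a set \<Rightarrow> 'b set) \<Rightarrow> bool" where
  "semialgebraic_quotient_iso M r N s f \<longleftrightarrow>
     semialgebraic M \<and> equiv M r \<and> semialgebraic r \<and>
     semialgebraic N \<and> equiv N s \<and> semialgebraic s \<and>
     homeomorphic_map (quotient_topology (top_of_set M) r) (quotient_topology (top_of_set N) s) f \<and>
     semialgebraic {(x, y). x \<in> M \<and> y \<in> N \<and> f (r `` {x}) = s `` {y}}"

section \<open>Matrices\<close>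

type_synonym 'n cmat = "((complex, 'n) vec, 'n) vec"

definition ctranspose :: "'n::finite cmat \<Rightarrow> 'n cmat" where
  "ctranspose A = (\<chi> i j. cnj (A $ j $ i))"

definition unitary :: "'n::finite cmat \<Rightarrow> bool" where
  "unitary U \<longleftrightarrow> ctranspose U ** U = mat 1 \<and> U ** ctranspose U = mat 1"

definition positive_definite :: "'n::finite cmat \<Rightarrow> bool" where
  "positive_definite X \<longleftrightarrow> ctranspose X = X \<and>
     (\<forall>v. v \<noteq> 0 \<longrightarrow> 0 < Re (\<Sum>i\<in>UNIV. \<Sum>j\<in>UNIV. cnj (v $ i) * X $ i $ j * v $ j))"

lemma ctranspose_ctranspose [simp]: "ctranspose (ctranspose A) = A"
  by (simp add: ctranspose_def vec_eq_iff)

lemma ctranspose_mult: "ctranspose (A ** B) = ctranspose B ** ctranspose (A :: 'n::finite cmat)"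
  by (simp add: ctranspose_def matrix_matrix_mult_def vec_eq_iff mult.commute)

lemma ctranspose_mat_1 [simp]: "ctranspose (mat 1) = mat 1"
  by (auto simp: ctranspose_def mat_def vec_eq_iff)

definition char_poly_mat :: "'n::finite cmat \<Rightarrow> complex poly" where
  "char_poly_mat M = det (\<chi> i j. (if i = j then [:0, 1:] else 0) - [:M $ i $ j:])"

text \<open>Eigenvalues, counted with algebraic multiplicity.\<close>
definition eigenvalues :: "'n::finite cmat \<Rightarrow> complex multiset" where
  "eigenvalues M = proots (char_poly_mat M)"

text \<open>
  The eigenvalues of \<open>A\<^sup>*A\<close> are real and nonnegative (see \<open>eigenvalues_gram_nonneg\<close> below), so taking
  real parts loses nothing.
\<close>
definition singular_values :: "'n::finite cmat \<Rightarrow> real multiset" where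
  "singular_values A = image_mset (\<lambda>z. sqrt (Re z)) (eigenvalues (ctranspose A ** A))"

section \<open>The two moduli spaces\<close>

definition mult_triples :: "('n::finite cmat \<times> 'n cmat \<times> 'n cmat) set" where
  "mult_triples = {(A, B, C). invertible A \<and> invertible B \<and> invertible C \<and> A ** B ** C = mat 1}"

definition mult_rel ::
  "(('n::finite cmat \<times> 'n cmat \<times> 'n cmat) \<times> ('n cmat \<times> 'n cmat \<times> 'n cmat)) set" where
  "mult_rel = {((A, B, C), (A', B', C')). (A, B, C) \<in> mult_triples \<and>
     (\<exists>U V W. unitary U \<and> unitary V \<and> unitary W \<and>
        A' = matrix_inv W ** A ** U \<and> B' = matrix_inv U ** B ** V \<and> C' = matrix_inv V ** C ** W)}"

definition pd_triples :: "('n::finite cmat \<times> 'n cmat \<times> 'n cmat) set" where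
  "pd_triples = {(X, Y, Z). positive_definite X \<and> positive_definite Y \<and> positive_definite Z}"

definition pd_rel ::
  "(('n::finite cmat \<times> 'n cmat \<times> 'n cmat) \<times> ('n cmat \<times> 'n cmat \<times> 'n cmat)) set" where
  "pd_rel = {((X, Y, Z), (X', Y', Z')). (X, Y, Z) \<in> pd_triples \<and>
     (\<exists>G. invertible G \<and> X' = ctranspose G ** X ** G \<and> Y' = ctranspose G ** Y ** G \<and>
        Z' = ctranspose G ** Z ** G)}"

section \<open>The determinantal form\<close>

text \<open>
  A polynomial in \<open>x, y, z\<close> is a nested univariate polynomial, with \<open>x\<close> innermost and \<open>z\<close> outermost.
  \<open>det_form_complex (X, Y, Z)\<close> is \<open>det (xX + yY + zZ)\<close>. For Hermitian \<open>X, Y, Z\<close> its coefficients are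
  real (see \<open>of_real_det_form\<close> below), and \<open>det_form\<close> is the same polynomial with real coefficients.
\<close>
definition det_form_complex :: "'n::finite cmat \<times> 'n cmat \<times> 'n cmat \<Rightarrow> complex poly poly poly" where
  "det_form_complex = (\<lambda>(X, Y, Z). det (\<chi> i j.
     [:[:[:0, 1:]:]:] * [:[:[:X $ i $ j:]:]:] +
     [:[:0, 1:]:] * [:[:[:Y $ i $ j:]:]:] +
     [:0, 1:] * [:[:[:Z $ i $ j:]:]:]))"

definition det_form :: "'n::finite cmat \<times> 'n cmat \<times> 'n cmat \<Rightarrow> real poly poly poly" where
  "det_form p = map_poly (map_poly (map_poly Re)) (det_form_complex p)"

text \<open>A class of polynomials up to nonzero real scalars is the set of all its representatives.\<close>
definition delta :: "('n::finite cmat \<times> 'n cmat \<times> 'n cmat) set \<Rightarrow> real poly poly poly set" where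
  "delta T = {smult [:[:c:]:] (det_form p) | c p. c \<noteq> 0 \<and> p \<in> T}"

text \<open>Substitution \<open>F(a, b, c)\<close> of univariate polynomials for \<open>x, y, z\<close>.\<close>
definition subst3 :: "real poly poly poly \<Rightarrow> real poly \<Rightarrow> real poly \<Rightarrow> real poly \<Rightarrow> real poly" where
  "subst3 F a b c = poly (map_poly (\<lambda>G. poly (map_poly (\<lambda>H. H \<circ>\<^sub>p a) G) b) F) c"

section \<open>Consistency of the definitions\<close>

lemma subst3_var:
  "subst3 [:[:[:0, 1:]:]:] a b c = a"
  "subst3 [:[:0, 1:]:] a b c = b"
  "subst3 [:0, 1:] a b c = c"
  by (simp_all add: subst3_def map_poly_pCons pcompose_pCons one_pCons pcompose_1)

lemma det_hom:
  fixes h :: "'a::comm_ring_1 \<Rightarrow> 'b::comm_ring_1" and M :: "'a^'n::finite^'n"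
  assumes add: "\<And>x y. h (x + y) = h x + h y" and mult: "\<And>x y. h (x * y) = h x * h y"
    and one: "h 1 = 1"
  shows "h (det M) = det (\<chi> i j. h (M $ i $ j))"
proof -
  have zero: "h 0 = 0" using add[of 0 0] by simp
  have uminus: "h (- x) = - h x" for x
    using add[of x "- x"] zero by (simp add: eq_neg_iff_add_eq_0 add.commute)
  have sum: "h (sum f A) = (\<Sum>x\<in>A. h (f x))" if "finite A" for f :: "('n \<Rightarrow> 'n) \<Rightarrow> 'a" and A
    using that by induction (auto simp: zero add)
  have prod: "h (prod f A) = (\<Prod>x\<in>A. h (f x))" if "finite A" for f :: "'n \<Rightarrow> 'a" and A
    using that by induction (auto simp: one mult)
  have sign: "h (of_int (sign p)) = of_int (sign p)" for p :: "'n \<Rightarrow> 'n"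
    by (auto simp: sign_def one uminus)
  show ?thesis
    by (simp add: det_def sum prod mult sign finite_permutations)
qed

lemma map_poly_hom:
  fixes h :: "'a::comm_ring_1 \<Rightarrow> 'b::comm_ring_1"
  assumes add: "\<And>x y. h (x + y) = h x + h y" and mult: "\<And>x y. h (x * y) = h x * h y"
    and one: "h 1 = 1"
  shows "map_poly h (p + q) = map_poly h p + map_poly h q"
    and "map_poly h (p * q) = map_poly h p * map_poly h q"
    and "map_poly h 1 = 1"
proof -
  have zero: "h 0 = 0" using add[of 0 0] by simp
  have sum: "h (sum f A) = (\<Sum>x\<in>A. h (f x))" if "finite A" for f :: "nat \<Rightarrow> 'a" and A
    using that by induction (auto simp: zero add)
  show "map_poly h (p + q) = map_poly h p + map_poly h q"
    by (rule poly_eqI) (simp add: coeff_map_poly zero add)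
  show "map_poly h (p * q) = map_poly h p * map_poly h q"
    by (rule poly_eqI) (simp add: coeff_map_poly zero coeff_mult sum mult)
  show "map_poly h 1 = 1"
    by (simp add: one)
qed

lemma poly_char_poly_mat: "poly (char_poly_mat M) z = det (mat z - M)"
proof -
  have "poly (char_poly_mat M) z =
      det (\<chi> i j. poly ((\<chi> i j. (if i = j then [:0, 1:] else 0) - [:M $ i $ j:]) $ i $ j) z)"
    unfolding char_poly_mat_def by (rule det_hom) simp_all
  also have "(\<chi> i j. poly ((\<chi> i j. (if i = j then [:0, 1:] else 0) - [:M $ i $ j:]) $ i $ j) z)
      = mat z - M"
    by (simp add: vec_eq_iff mat_def)
  finally show ?thesis .
qed

lemma det_eq_0_iff_kernel:
  fixes N :: "'n::finite cmat"
  shows "det N = 0 \<longleftrightarrow> (\<exists>v. v \<noteq> 0 \<and> N *v v = 0)"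
  using matrix_left_invertible_ker[of N] invertible_det_nz[of N] invertible_left_inverse[of N]
  by blast

lemma char_poly_root_iff: "poly (char_poly_mat M) z = 0 \<longleftrightarrow> (\<exists>v. v \<noteq> 0 \<and> M *v v = z *s v)"
proof -
  have "(mat z - M) *v v = z *s v - M *v v" for v
  proof -
    have "mat z *v v = z *s v"
      by (simp add: vec_eq_iff matrix_vector_mult_def mat_def if_distrib if_distribR
          cong: if_cong)
    then show ?thesis by (simp add: matrix_vector_mult_diff_rdistrib)
  qed
  then show ?thesis
    by (simp add: poly_char_poly_mat det_eq_0_iff_kernel) metis
qed

lemma char_poly_mat_nonzero: "char_poly_mat M \<noteq> 0"
proof
  assume 0: "char_poly_mat M = 0"
  have "linear ((*v) M)"
    by (rule linearI) (simp_all add: matrix_vector_right_distrib vec_eq_iff matrix_vector_mult_def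
        scaleR_sum_right distrib_left sum.distrib)
  then obtain K where K: "\<And>v. norm (M *v v) \<le> K * norm v" "0 < K"
    using linear_bounded_pos[of "(*v) M"] by blast
  obtain v where v: "v \<noteq> 0" "M *v v = complex_of_real (K + 1) *s v"
    using char_poly_root_iff[of M "complex_of_real (K + 1)"] 0 by auto
  have "complex_of_real (K + 1) *s v = (K + 1) *\<^sub>R v"
    by (simp add: vec_eq_iff scaleR_conv_of_real[of _ "_ :: complex"] algebra_simps)
  with v have "norm (M *v v) = (K + 1) * norm v" using K by simp
  with K(1)[of v] v(1) show False by (simp add: algebra_simps)
qed

lemma eigenvalues_iff:
  "z \<in># eigenvalues M \<longleftrightarrow> (\<exists>v. v \<noteq> 0 \<and> M *v v = z *s v)"
  using char_poly_mat_nonzero[of M] by (simp add: eigenvalues_def char_poly_root_iff)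

lemma ctranspose_adjoint:
  fixes A :: "'n::finite cmat"
  shows "(\<Sum>i\<in>UNIV. cnj (v $ i) * (ctranspose A *v w) $ i) = (\<Sum>i\<in>UNIV. cnj ((A *v v) $ i) * w $ i)"
proof -
  have "(\<Sum>i\<in>UNIV. cnj (v $ i) * (ctranspose A *v w) $ i)
      = (\<Sum>i\<in>UNIV. \<Sum>j\<in>UNIV. cnj (v $ i) * cnj (A $ j $ i) * w $ j)"
    by (simp add: matrix_vector_mult_def ctranspose_def sum_distrib_left mult.assoc)
  also have "\<dots> = (\<Sum>j\<in>UNIV. \<Sum>i\<in>UNIV. cnj (v $ i) * cnj (A $ j $ i) * w $ j)"
    by (rule sum.swap)
  also have "\<dots> = (\<Sum>i\<in>UNIV. cnj ((A *v v) $ i) * w $ i)"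
    by (simp add: matrix_vector_mult_def sum_distrib_right sum_distrib_left mult_ac)
  finally show ?thesis .
qed

lemma sum_cnj_self: "(\<Sum>i\<in>UNIV. cnj (v $ i) * v $ i) = complex_of_real ((norm v)\<^sup>2)"
  for v :: "complex^'n::finite"
proof -
  have "(norm v)\<^sup>2 = (\<Sum>i\<in>UNIV. (cmod (v $ i))\<^sup>2)"
    by (simp add: norm_vec_def L2_set_def sum_nonneg)
  then show ?thesis by (simp add: complex_norm_square mult.commute del: of_real_power)
qed

lemma eigenvalues_gram_nonneg:
  assumes "z \<in># eigenvalues (ctranspose A ** A)"
  shows "z \<in> \<real>" "0 \<le> Re z"
proof -
  obtain v where v: "v \<noteq> 0" "(ctranspose A ** A) *v v = z *s v"
    using assms eigenvalues_iff by blast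
  have "z * (\<Sum>i\<in>UNIV. cnj (v $ i) * v $ i) = (\<Sum>i\<in>UNIV. cnj (v $ i) * (z *s v) $ i)"
    by (simp add: sum_distrib_left mult_ac)
  also have "\<dots> = (\<Sum>i\<in>UNIV. cnj ((A *v v) $ i) * (A *v v) $ i)"
    using v(2) ctranspose_adjoint[of v A "A *v v"] by (simp add: matrix_vector_mul_assoc)
  finally have "z * complex_of_real ((norm v)\<^sup>2) = complex_of_real ((norm (A *v v))\<^sup>2)"
    by (simp only: sum_cnj_self)
  then have "z = complex_of_real ((norm (A *v v))\<^sup>2 / (norm v)\<^sup>2)"
    using v(1) by (simp add: field_simps)
  then show "z \<in> \<real>" "0 \<le> Re z" by (metis Reals_of_real, simp)
qed

lemma matrix_inv_cancel:
  assumes "invertible G"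
  shows "G ** matrix_inv G = mat 1" "matrix_inv G ** G = mat 1"
  using assms unfolding invertible_def matrix_inv_def by (metis (mono_tags, lifting) someI_ex)+

lemma unitary_invertible: "unitary U \<Longrightarrow> invertible U"
  unfolding unitary_def invertible_def by blast

lemma matrix_inv_eq:
  fixes G :: "'n::finite cmat"
  assumes "G ** H = mat 1" "H ** G = mat 1"
  shows "matrix_inv G = H"
proof -
  have "invertible G" using assms invertible_def by blast
  then show ?thesis
    by (metis assms(1) matrix_inv_cancel(2) matrix_mul_assoc matrix_mul_lid matrix_mul_rid)
qed

lemma unitary_inv: "unitary U \<Longrightarrow> matrix_inv U = ctranspose U"
  by (rule matrix_inv_eq) (auto simp: unitary_def)

lemma unitary_one: "unitary (mat 1)"
  by (simp add: unitary_def)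

lemma unitary_ctranspose: "unitary U \<Longrightarrow> unitary (ctranspose U)"
  by (simp add: unitary_def)

lemma unitary_mult:
  assumes "unitary U" "unitary V" shows "unitary (U ** V)"
  unfolding unitary_def
proof
  show "ctranspose (U ** V) ** (U ** V) = mat 1"
    using assms unfolding unitary_def ctranspose_mult
    by (metis matrix_mul_assoc matrix_mul_lid)
  show "U ** V ** ctranspose (U ** V) = mat 1"
    using assms unfolding unitary_def ctranspose_mult
    by (metis matrix_mul_assoc matrix_mul_lid)
qed

lemma mult_rel_closed:
  assumes "(A, B, C) \<in> mult_triples" "unitary U" "unitary V" "unitary W"
  shows "(ctranspose W ** A ** U, ctranspose U ** B ** V, ctranspose V ** C ** W) \<in> mult_triples"
proof -
  have inv: "invertible (ctranspose W ** A ** U)" "invertible (ctranspose U ** B ** V)"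
    "invertible (ctranspose V ** C ** W)"
    using assms by (auto simp: mult_triples_def
        intro!: invertible_mult unitary_invertible[OF unitary_ctranspose]
        unitary_invertible[of U] unitary_invertible[of V] unitary_invertible[of W])
  have U: "U ** (ctranspose U ** X) = X" for X :: "'a cmat"
    using assms(2) by (simp add: matrix_mul_assoc unitary_def)
  have V: "V ** (ctranspose V ** X) = X" for X :: "'a cmat"
    using assms(3) by (simp add: matrix_mul_assoc unitary_def)
  have ABC: "A ** (B ** (C ** X)) = X" for X :: "'a cmat"
    using assms(1) by (simp add: mult_triples_def matrix_mul_assoc)
  have "ctranspose W ** A ** U ** (ctranspose U ** B ** V) ** (ctranspose V ** C ** W)
      = ctranspose W ** W"
    by (simp add: matrix_mul_assoc[symmetric] U V ABC)
  then show ?thesis using inv assms(4) by (simp add: mult_triples_def unitary_def)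
qed

lemma equiv_mult_rel: "equiv (mult_triples :: ('n::finite cmat \<times> 'n cmat \<times> 'n cmat) set) mult_rel"
  (is "equiv ?M ?R")
proof (rule equivI)
  show "?R \<subseteq> ?M \<times> ?M"
    by (auto simp: mult_rel_def unitary_inv mult_rel_closed)
  have inv1: "matrix_inv (mat 1 :: 'n cmat) = mat 1" by (rule matrix_inv_eq) simp_all
  show "refl_on ?M ?R"
    by (rule refl_onI) (auto simp: mult_rel_def inv1 intro!: exI[of _ "mat 1"] unitary_one)
  show "sym ?R"
  proof (rule symI)
    fix p q :: "'n cmat \<times> 'n cmat \<times> 'n cmat"
    assume pq: "(p, q) \<in> mult_rel"
    obtain A B C where p: "p = (A, B, C)" by (cases p)
    obtain U V W where UVW: "unitary U" "unitary V" "unitary W"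
      and q: "q = (ctranspose W ** A ** U, ctranspose U ** B ** V, ctranspose V ** C ** W)"
      and T: "(A, B, C) \<in> mult_triples"
      using pq p by (cases q) (auto simp: mult_rel_def unitary_inv)
    have 1: "T ** (ctranspose T ** X ** S) ** ctranspose S = X"
      if "unitary T" "unitary S" for S T X :: "'n cmat"
    proof -
      have "T ** (ctranspose T ** X ** S) ** ctranspose S
          = (T ** ctranspose T) ** X ** (S ** ctranspose S)"
        by (simp only: matrix_mul_assoc)
      then show ?thesis using that by (simp add: unitary_def)
    qed
    show "(q, p) \<in> mult_rel"
      unfolding mult_rel_def q p
      using mult_rel_closed[OF T UVW] UVW
      unfolding mem_Collect_eq prod.case
      by (intro conjI exI[of _ "ctranspose U"] exI[of _ "ctranspose V"] exI[of _ "ctranspose W"])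
        (simp_all add: unitary_inv unitary_ctranspose 1)
  qed
  show "trans ?R"
  proof (rule transI)
    fix p q s :: "'n cmat \<times> 'n cmat \<times> 'n cmat"
    assume pq: "(p, q) \<in> mult_rel" and qs: "(q, s) \<in> mult_rel"
    obtain A B C where p: "p = (A, B, C)" by (cases p)
    obtain U V W where UVW: "unitary U" "unitary V" "unitary W"
      and q: "q = (ctranspose W ** A ** U, ctranspose U ** B ** V, ctranspose V ** C ** W)"
      and T: "(A, B, C) \<in> mult_triples"
      using pq p by (cases q) (auto simp: mult_rel_def unitary_inv)
    obtain U' V' W' where UVW': "unitary U'" "unitary V'" "unitary W'"
      and s: "s = (ctranspose W' ** (ctranspose W ** A ** U) ** U',
        ctranspose U' ** (ctranspose U ** B ** V) ** V',
        ctranspose V' ** (ctranspose V ** C ** W) ** W')"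
      using qs q by (cases s) (auto simp: mult_rel_def unitary_inv)
    show "(p, s) \<in> mult_rel"
      unfolding mult_rel_def s p
      using T UVW UVW'
      unfolding mem_Collect_eq prod.case
      by (intro conjI exI[of _ "U ** U'"] exI[of _ "V ** V'"] exI[of _ "W ** W'"])
        (simp_all add: unitary_inv unitary_mult ctranspose_mult matrix_mul_assoc)
  qed
qed

lemma quadratic_form_eq:
  fixes X :: "'n::finite cmat"
  shows "(\<Sum>i\<in>UNIV. \<Sum>j\<in>UNIV. cnj (v $ i) * X $ i $ j * v $ j)
    = (\<Sum>i\<in>UNIV. cnj (v $ i) * (X *v v) $ i)"
  by (simp add: matrix_vector_mult_def sum_distrib_left mult.assoc)

lemma positive_definite_congruence:
  assumes "positive_definite X" "invertible G"
  shows "positive_definite (ctranspose G ** X ** G)"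
  unfolding positive_definite_def quadratic_form_eq
proof (intro conjI allI impI)
  show "ctranspose (ctranspose G ** X ** G) = ctranspose G ** X ** G"
    using assms(1) by (simp add: ctranspose_mult positive_definite_def matrix_mul_assoc)
  fix v :: "complex^'a" assume v: "v \<noteq> 0"
  have "matrix_inv G *v (G *v v) = v"
    using assms(2) by (simp add: matrix_vector_mul_assoc matrix_inv_cancel)
  then have "G *v v \<noteq> 0" using v by auto
  moreover have "(\<Sum>i\<in>UNIV. cnj (v $ i) * ((ctranspose G ** X ** G) *v v) $ i)
      = (\<Sum>i\<in>UNIV. cnj ((G *v v) $ i) * (X *v (G *v v)) $ i)"
    using ctranspose_adjoint[of v G "X *v (G *v v)"]
    by (simp add: matrix_vector_mul_assoc matrix_mul_assoc)
  ultimately show "0 < Re (\<Sum>i\<in>UNIV. cnj (v $ i) * ((ctranspose G ** X ** G) *v v) $ i)"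
    using assms(1) unfolding positive_definite_def quadratic_form_eq by metis
qed

lemma equiv_pd_rel: "equiv (pd_triples :: ('n::finite cmat \<times> 'n cmat \<times> 'n cmat) set) pd_rel"
  (is "equiv ?M ?R")
proof (rule equivI)
  show "?R \<subseteq> ?M \<times> ?M"
    by (auto simp: pd_rel_def pd_triples_def positive_definite_congruence)
  have "invertible (mat 1 :: 'n cmat)" unfolding invertible_def by (intro exI[of _ "mat 1"]) simp
  then show "refl_on ?M ?R"
    by (intro refl_onI) (auto simp: pd_rel_def intro!: exI[of _ "mat 1"])
  show "sym ?R"
  proof (rule symI)
    fix p q :: "'n cmat \<times> 'n cmat \<times> 'n cmat"
    assume pq: "(p, q) \<in> pd_rel"
    obtain X Y Z where p: "p = (X, Y, Z)" by (cases p)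
    obtain G where G: "invertible G"
      and q: "q = (ctranspose G ** X ** G, ctranspose G ** Y ** G, ctranspose G ** Z ** G)"
      and T: "(X, Y, Z) \<in> pd_triples"
      using pq p by (cases q) (auto simp: pd_rel_def)
    let ?H = "matrix_inv G"
    have H: "invertible ?H" using matrix_inv_cancel[OF G] invertible_def by blast
    have 1: "ctranspose ?H ** (ctranspose G ** M ** G) ** ?H = M" for M
    proof -
      have "ctranspose ?H ** (ctranspose G ** M ** G) ** ?H
          = ctranspose (G ** ?H) ** M ** (G ** ?H)"
        by (simp add: ctranspose_mult matrix_mul_assoc)
      then show ?thesis by (simp add: matrix_inv_cancel[OF G])
    qed
    show "(q, p) \<in> pd_rel"
      unfolding pd_rel_def q p using T G H
      by (auto simp: pd_triples_def positive_definite_congruence 1 intro!: exI[of _ ?H])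
  qed
  show "trans ?R"
  proof (rule transI)
    fix p q s :: "'n cmat \<times> 'n cmat \<times> 'n cmat"
    assume pq: "(p, q) \<in> pd_rel" and qs: "(q, s) \<in> pd_rel"
    obtain X Y Z where p: "p = (X, Y, Z)" by (cases p)
    obtain G where G: "invertible G"
      and q: "q = (ctranspose G ** X ** G, ctranspose G ** Y ** G, ctranspose G ** Z ** G)"
      and T: "(X, Y, Z) \<in> pd_triples"
      using pq p by (cases q) (auto simp: pd_rel_def)
    obtain H where H: "invertible H"
      and s: "s = (ctranspose H ** (ctranspose G ** X ** G) ** H,
        ctranspose H ** (ctranspose G ** Y ** G) ** H,
        ctranspose H ** (ctranspose G ** Z ** G) ** H)"
      using qs q by (cases s) (auto simp: pd_rel_def)
    show "(p, s) \<in> pd_rel"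
      unfolding pd_rel_def s p using T G H
      by (auto simp: ctranspose_mult matrix_mul_assoc invertible_mult intro!: exI[of _ "G ** H"])
  qed
qed

lemma of_real_det_form:
  assumes "p \<in> pd_triples"
  shows "map_poly (map_poly (map_poly complex_of_real)) (det_form p) = det_form_complex p"
proof -
  obtain X Y Z where p: "p = (X, Y, Z)" by (cases p)
  have herm: "cnj (M $ j $ i) = M $ i $ j" if "positive_definite M" for M :: "'a cmat" and i j
  proof -
    have "ctranspose M = M" using that by (simp add: positive_definite_def)
    then have "ctranspose M $ i $ j = M $ i $ j" by simp
    then show ?thesis by (simp add: ctranspose_def)
  qed
  let ?h1 = "map_poly cnj" and ?h2 = "map_poly (map_poly cnj)"
    and ?h = "map_poly (map_poly (map_poly cnj))"
  let ?N = "\<chi> i j::'a. [:[:[:0, 1:]:]:] * [:[:[:X $ i $ j:]:]:] +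
     [:[:0, 1:]:] * [:[:[:Y $ i $ j:]:]:] + [:0, 1:] * [:[:[:Z $ i $ j:]:]:]"
  note h1 = map_poly_hom[of cnj, OF complex_cnj_add complex_cnj_mult complex_cnj_one]
  note h2 = map_poly_hom[of ?h1, OF h1]
  note h3 = map_poly_hom[of ?h2, OF h2]
  have "?h (det ?N) = det (\<chi> i j. ?h (?N $ i $ j))"
    by (rule det_hom) (fact h3)+
  also have "(\<chi> i j. ?h (?N $ i $ j)) = transpose ?N"
    using assms by (simp add: vec_eq_iff transpose_def p pd_triples_def h3 map_poly_pCons herm
        del: mult_pCons_left mult_pCons_right)
  also have "det (transpose ?N) = det ?N" by (rule det_transpose)
  finally have *: "?h (det_form_complex p) = det_form_complex p"
    by (simp add: det_form_complex_def p)
  have "coeff (coeff (coeff (det_form_complex p) i) j) k \<in> \<real>" for i j k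
  proof -
    have "cnj (coeff (coeff (coeff (det_form_complex p) i) j) k)
        = coeff (coeff (coeff (?h (det_form_complex p)) i) j) k"
      by (simp add: coeff_map_poly)
    then show ?thesis unfolding * by (metis Reals_cnj_iff)
  qed
  then show ?thesis
    by (auto intro!: poly_eqI simp: det_form_def coeff_map_poly)
qed

lemma det_pencil_congruence:
  fixes h :: "complex \<Rightarrow> 'r::comm_ring_1" and x y z :: 'r and M N X Y Z :: "'n::finite cmat"
  assumes add: "\<And>a b. h (a + b) = h a + h b" and mult: "\<And>a b. h (a * b) = h a * h b"
    and one: "h 1 = 1"
  defines "P \<equiv> (\<lambda>X Y Z. (\<chi> i j. x * h (X $ i $ j) + y * h (Y $ i $ j) + z * h (Z $ i $ j)) :: 'r^'n^'n)"
  shows "det (P (M ** X ** N) (M ** Y ** N) (M ** Z ** N)) = h (det M) * det (P X Y Z) * h (det N)"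
proof -
  have zero: "h 0 = 0" using add[of 0 0] by simp
  have sum: "h (sum f A) = (\<Sum>i\<in>A. h (f i))" if "finite A" for f and A :: "'n set"
    using that by induction (simp_all add: zero add)
  let ?C = "\<lambda>M::'n cmat. (\<chi> i j. h (M $ i $ j)) :: 'r^'n^'n"
  have lin1: "P (M ** X) (M ** Y) (M ** Z) = ?C M ** P X Y Z" for M X Y Z
    unfolding vec_eq_iff
  proof (intro allI)
    fix i j
    have "(?C M ** P X Y Z) $ i $ j
        = (\<Sum>k\<in>UNIV. x * (h (M $ i $ k) * h (X $ k $ j)) + y * (h (M $ i $ k) * h (Y $ k $ j))
            + z * (h (M $ i $ k) * h (Z $ k $ j)))"
      by (simp add: P_def matrix_matrix_mult_def algebra_simps)
    also have "\<dots> = P (M ** X) (M ** Y) (M ** Z) $ i $ j"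
      by (simp add: P_def matrix_matrix_mult_def sum mult sum.distrib sum_distrib_left)
    finally show "P (M ** X) (M ** Y) (M ** Z) $ i $ j = (?C M ** P X Y Z) $ i $ j" ..
  qed
  have lin2: "P (X ** N) (Y ** N) (Z ** N) = P X Y Z ** ?C N" for N X Y Z
    unfolding vec_eq_iff
  proof (intro allI)
    fix i j
    have "(P X Y Z ** ?C N) $ i $ j
        = (\<Sum>k\<in>UNIV. x * (h (X $ i $ k) * h (N $ k $ j)) + y * (h (Y $ i $ k) * h (N $ k $ j))
            + z * (h (Z $ i $ k) * h (N $ k $ j)))"
      by (simp add: P_def matrix_matrix_mult_def algebra_simps)
    also have "\<dots> = P (X ** N) (Y ** N) (Z ** N) $ i $ j"
      by (simp add: P_def matrix_matrix_mult_def sum mult sum.distrib sum_distrib_left)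
    finally show "P (X ** N) (Y ** N) (Z ** N) $ i $ j = (P X Y Z ** ?C N) $ i $ j" ..
  qed
  have detC: "det (?C M) = h (det M)" for M :: "'n cmat"
    using det_hom[of h M] add mult one by simp
  show ?thesis by (simp only: lin1 lin2 det_mul detC)
qed

lemma det_form_congruence:
  fixes X Y Z G :: "'n::finite cmat"
  shows "det_form (ctranspose G ** X ** G, ctranspose G ** Y ** G, ctranspose G ** Z ** G)
    = smult [:[:(cmod (det G))\<^sup>2:]:] (det_form (X, Y, Z))"
proof -
  let ?c = "\<lambda>a::complex. [:[:[:a:]:]:]" and ?r = "(cmod (det G))\<^sup>2"
  have "cnj (det (transpose G)) = det (ctranspose G)"
    by (subst det_hom) (simp_all add: ctranspose_def transpose_def)
  then have detct: "det (ctranspose G) = cnj (det G)" by simp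
  have hom: "?c (a + b) = ?c a + ?c b" "?c (a * b) = ?c a * ?c b" "?c 1 = 1" for a b
    by (simp_all add: one_pCons)
  have "det_form_complex (ctranspose G ** X ** G, ctranspose G ** Y ** G, ctranspose G ** Z ** G)
      = ?c (cnj (det G)) * det_form_complex (X, Y, Z) * ?c (det G)"
    unfolding det_form_complex_def split detct[symmetric]
    by (rule det_pencil_congruence) (fact hom)+
  also have "\<dots> = ?c (det G * cnj (det G)) * det_form_complex (X, Y, Z)"
    unfolding hom(2) by (simp only: mult_ac)
  also have "\<dots> = smult [:[:of_real ?r:]:] (det_form_complex (X, Y, Z))"
    unfolding complex_norm_square by simp
  finally have *: "det_form_complex
      (ctranspose G ** X ** G, ctranspose G ** Y ** G, ctranspose G ** Z ** G)
      = smult [:[:of_real ?r:]:] (det_form_complex (X, Y, Z))" .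
  have Re: "Re (of_real a * b) = a * Re b" for a b by simp
  show ?thesis
    unfolding det_form_def *
    by (intro poly_eqI) (simp add: coeff_map_poly Re del: of_real_power)
qed

lemma delta_class:
  assumes "p \<in> pd_triples"
  shows "delta (pd_rel `` {p}) = {smult [:[:c:]:] (det_form p) | c. c \<noteq> 0}"
proof
  show "{smult [:[:c:]:] (det_form p) |c. c \<noteq> 0} \<subseteq> delta (pd_rel `` {p})"
    using equiv_class_self[OF equiv_pd_rel assms] unfolding delta_def by blast
  show "delta (pd_rel `` {p}) \<subseteq> {smult [:[:c:]:] (det_form p) |c. c \<noteq> 0}"
  proof
    fix F assume "F \<in> delta (pd_rel `` {p})"
    then obtain c q where F: "F = smult [:[:c:]:] (det_form q)" "c \<noteq> 0" and q: "(p, q) \<in> pd_rel"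
      unfolding delta_def by blast
    obtain X Y Z where p: "p = (X, Y, Z)" by (cases p)
    obtain G where G: "invertible G"
      and q': "q = (ctranspose G ** X ** G, ctranspose G ** Y ** G, ctranspose G ** Z ** G)"
      using q p by (cases q) (auto simp: pd_rel_def)
    have "F = smult [:[:c * (cmod (det G))\<^sup>2:]:] (det_form p)"
      by (simp add: F q' p det_form_congruence)
    moreover have "c * (cmod (det G))\<^sup>2 \<noteq> 0" using F(2) G by (simp add: invertible_det_nz)
    ultimately show "F \<in> {smult [:[:c:]:] (det_form p) |c. c \<noteq> 0}" by blast
  qed
qed

end

theory Submission
  imports Defs
begin

text \<open>
  Think of \<open>A\<close>, \<open>B\<close>, \<open>C\<close> as invertible maps \<open>V\<^sub>1 \<rightarrow> V\<^sub>3\<close>, \<open>V\<^sub>2 \<rightarrow> V\<^sub>1\<close>, \<open>V\<^sub>3 \<rightarrow> V\<^sub>2\<close> between Hermitian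
  spaces whose composite around the triangle is the identity. These maps identify
  the three spaces, so they are the same thing as one vector space with three positive definite forms. Pulling the forms of \<open>V\<^sub>3\<close>, \<open>V\<^sub>1\<close>,
  \<open>V\<^sub>2\<close> back to \<open>V\<^sub>1\<close> gives the polynomial map
  \<open>(A, B, C) \<mapsto> (A\<^sup>*A, 1, (CA)\<^sup>*(CA))\<close>, called \<open>gram_triple\<close> below, and unitary changes of
  bases of the three spaces become congruence by one invertible matrix. Conversely, factoring
  positive definite matrices as \<open>X = R\<^sup>*R\<close>, \<open>Y = S\<^sup>*S\<close>,
  \<open>Z = T\<^sup>*T\<close> gives the triple \<open>(R S\<^sup>-\<^sup>1, S T\<^sup>-\<^sup>1, T R\<^sup>-\<^sup>1)\<close>, whose Gram triple is congruent to
  \<open>(X, Y, Z)\<close>. So the induced map \<open>beta\<close> of orbit spaces is a bijection (\<open>mult_rel_iff_gram\<close>,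
  \<open>gram_quotient_triple\<close>).

  Topology. The inverse of \<open>beta\<close> is continuous although the factor \<open>R\<close> of \<open>X\<close> is not unique: the map
  \<open>R \<mapsto> R\<^sup>*R\<close> is proper, because its value bounds the norm of \<open>R\<close>, hence it is closed and a quotient map
  onto the positive definite matrices (\<open>quotient_map_gram3\<close>). No continuous choice of \<open>R\<close> has to be made.

  Semialgebraicity. The orbit relations are images under projection of algebraic sets, and describing
  them by polynomial inequalities would in general require full quantifier elimination over the reals.
  Here the quadratic condition \<open>G\<^sup>*XG = X'\<close>, \<open>G\<^sup>*YG = Y'\<close>, \<open>G\<^sup>*ZG = Z'\<close> can be replaced by the linear one
  \<open>PX = X'Q\<close>, \<open>PY = Y'Q\<close>, \<open>PZ = Z'Q\<close> with \<open>P\<close> invertible: a polar decomposition turns a similarity of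
  self-adjoint operators into a unitary one (\<open>unitary_of_similar_hermitian\<close>,
  \<open>pd_rel_iff_equivalent\<close>). A linear system together with one polynomial inequation is then eliminated
  one equation at a time (\<open>semialgebraic_ex_linear\<close>). Positive definiteness is expressed by the signs of
  the coefficients of the characteristic polynomial (\<open>positive_definite_iff_coeffs\<close>).

  Singular values. At the Gram triple, the three restrictions of the determinantal form are nonzero
  multiples of the characteristic polynomials of \<open>A\<^sup>*A\<close>, \<open>B\<^sup>*B\<close> and \<open>C\<^sup>*C\<close>, which split over the reals by
  the spectral theorem (\<open>singular_values_det_form\<close>).
\<close>

section \<open>Semialgebraic sets and elimination of linear unknowns\<close>

lemma polynomial_function_bounded_linear_comp:
  "bounded_linear h \<Longrightarrow> polynomial_function f \<Longrightarrow> polynomial_function (\<lambda>x. h (f x))"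
  using polynomial_function_compose[of f h] polynomial_function_bounded_linear[of h]
  by (simp add: o_def)

lemma polynomial_function_fst: "polynomial_function f \<Longrightarrow> polynomial_function (\<lambda>x. fst (f x))"
  by (rule polynomial_function_bounded_linear_comp[OF bounded_linear_fst])

lemma polynomial_function_snd: "polynomial_function f \<Longrightarrow> polynomial_function (\<lambda>x. snd (f x))"
  by (rule polynomial_function_bounded_linear_comp[OF bounded_linear_snd])

lemma polynomial_function_real_mult:
  fixes f g :: "'a::real_normed_vector \<Rightarrow> real"
  shows "polynomial_function f \<Longrightarrow> polynomial_function g \<Longrightarrow> polynomial_function (\<lambda>x. f x * g x)"
  using polynomial_function_mult[of f g] by simp

lemma polynomial_function_inner_right:
  fixes f g :: "'a::real_normed_vector \<Rightarrow> 'b::euclidean_space"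
  assumes "polynomial_function f" "polynomial_function g"
  shows "polynomial_function (\<lambda>x. f x \<bullet> g x)"
  by (subst euclidean_inner)
    (use assms in \<open>auto intro!: polynomial_function_sum polynomial_function_real_mult\<close>)

lemma polynomial_function_Pair:
  fixes f :: "'a::real_normed_vector \<Rightarrow> 'b::euclidean_space" and g :: "'a \<Rightarrow> 'c::euclidean_space"
  assumes "polynomial_function f" "polynomial_function g"
  shows "polynomial_function (\<lambda>x. (f x, g x))"
  using assms unfolding polynomial_function_iff_Basis_inner
  by (auto simp: Basis_prod_def inner_Pair)

lemma polynomial_function_comp2:
  "polynomial_function f \<Longrightarrow> polynomial_function g \<Longrightarrow> polynomial_function (\<lambda>x. f (g x))"
  using polynomial_function_compose[of g f] by (simp add: o_def)

lemmas polynomial_function_intros =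
  polynomial_function_const polynomial_function_id polynomial_function_add
  polynomial_function_minus polynomial_function_diff polynomial_function_mult
  polynomial_function_real_mult polynomial_function_inner_right
  polynomial_function_fst polynomial_function_snd polynomial_function_Pair

lemma semialgebraic_vimage:
  fixes g :: "'a::euclidean_space \<Rightarrow> 'b::euclidean_space"
  assumes "semialgebraic S" and g: "polynomial_function g"
  shows "semialgebraic {x. g x \<in> S}"
  using assms(1)
proof induction
  case (pos p)
  have "real_polynomial_function (p \<circ> g)" using g pos by (rule real_polynomial_function_compose)
  then show ?case using semialgebraic.pos by fastforce
next
  case (compl S)
  then show ?case using semialgebraic.compl[OF compl.IH] by (simp add: Compl_eq)
next
  case (un S T)
  then show ?case using semialgebraic.un[OF un.IH] by (simp add: Collect_disj_eq)
qed

lemma semialgebraic_not: "semialgebraic {x. P x} \<Longrightarrow> semialgebraic {x. \<not> P x}"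
  using semialgebraic.compl[of "{x. P x}"] by (simp add: Compl_eq)

lemma semialgebraic_disj:
  "semialgebraic {x. P x} \<Longrightarrow> semialgebraic {x. Q x} \<Longrightarrow> semialgebraic {x. P x \<or> Q x}"
  using semialgebraic.un[of "{x. P x}" "{x. Q x}"] by (simp add: Collect_disj_eq)

lemma semialgebraic_conj:
  assumes "semialgebraic {x. P x}" "semialgebraic {x. Q x}"
  shows "semialgebraic {x. P x \<and> Q x}"
  using semialgebraic_not[OF semialgebraic_disj[OF assms[THEN semialgebraic_not]]] by simp

lemma semialgebraic_const: "semialgebraic {x :: 'a::euclidean_space. P}"
proof (cases P)
  case True
  then show ?thesis using semialgebraic.pos[of "\<lambda>x::'a. 1"] by (simp add: real_polynomial_function_eq)
next
  case False
  then show ?thesis using semialgebraic.pos[of "\<lambda>x::'a. 0"] by (simp add: real_polynomial_function_eq)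
qed

lemma semialgebraic_ball:
  assumes "finite I" "\<And>i. i \<in> I \<Longrightarrow> semialgebraic {x :: 'a::euclidean_space. P i x}"
  shows "semialgebraic {x. \<forall>i\<in>I. P i x}"
  using assms
proof (induction I)
  case empty
  show ?case using semialgebraic_const[of True] by simp
next
  case (insert i I)
  then show ?case by (simp add: semialgebraic_conj)
qed

lemma semialgebraic_bex:
  assumes "finite I" "\<And>i. i \<in> I \<Longrightarrow> semialgebraic {x :: 'a::euclidean_space. P i x}"
  shows "semialgebraic {x. \<exists>i\<in>I. P i x}"
proof -
  have "semialgebraic {x. \<forall>i\<in>I. \<not> P i x}"
    using assms by (intro semialgebraic_ball semialgebraic_not)
  from semialgebraic_not[OF this] show ?thesis by simp
qed

lemma semialgebraic_nonneg:
  fixes f :: "'a::euclidean_space \<Rightarrow> real"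
  assumes "polynomial_function f"
  shows "semialgebraic {x. 0 \<le> f x}"
proof -
  have "real_polynomial_function (\<lambda>x. - f x)"
    using assms by (simp add: real_polynomial_function_eq polynomial_function_minus)
  from semialgebraic_not[OF semialgebraic.pos[OF this]] show ?thesis by (simp add: not_less)
qed

lemma semialgebraic_eq:
  fixes f g :: "'a::euclidean_space \<Rightarrow> 'b::euclidean_space"
  assumes "polynomial_function f" "polynomial_function g"
  shows "semialgebraic {x. f x = g x}"
proof -
  have "polynomial_function (\<lambda>x. - ((f x - g x) \<bullet> (f x - g x)))"
    using assms by (intro polynomial_function_intros)
  moreover have "0 \<le> - ((f x - g x) \<bullet> (f x - g x)) \<longleftrightarrow> f x = g x" for x
    using inner_gt_zero_iff[of "f x - g x"] by (auto simp del: inner_gt_zero_iff)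
  ultimately show ?thesis using semialgebraic_nonneg by force
qed

text \<open>
  A polynomial in two groups of variables is a finite sum of products, because this holds for linear
  functions and constants and is kept by sums and products.
\<close>
lemma polynomial_function_separated:
  fixes f :: "'a::euclidean_space \<times> 'b::euclidean_space \<Rightarrow> real"
  assumes "real_polynomial_function f"
  shows "\<exists>gs. (\<forall>(g, h) \<in> set gs. polynomial_function g) \<and>
    (\<forall>x y. f (x, y) = (\<Sum>(g, h)\<leftarrow>gs. g x * h y))"
  using assms
proof induction
  case (linear f)
  have split: "f (x, y) = f (x, 0) + f (0, y)" for x y
    using linear_add[OF bounded_linear.linear[OF linear], of "(x, 0)" "(0, y)"] by simp
  have "bounded_linear (\<lambda>x. f (x, 0))"
    using bounded_linear_compose[OF linear bounded_linear_Pair[OF bounded_linear_ident bounded_linear_zero]]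
    by simp
  then have "polynomial_function (\<lambda>x. f (x, 0))" by (rule polynomial_function_bounded_linear)
  then show ?case
    by (intro exI[of _ "[(\<lambda>x. f (x, 0), \<lambda>y. 1), (\<lambda>x. 1, \<lambda>y. f (0, y))]"])
      (simp, intro allI split)
next
  case (const c)
  show ?case by (intro exI[of _ "[(\<lambda>x. c, \<lambda>y. 1)]"]) auto
next
  case (add f f')
  then obtain gs gs' where "\<forall>(g, h) \<in> set gs. polynomial_function g"
    "\<forall>x y. f (x, y) = (\<Sum>(g, h)\<leftarrow>gs. g x * h y)" "\<forall>(g, h) \<in> set gs'. polynomial_function g"
    "\<forall>x y. f' (x, y) = (\<Sum>(g, h)\<leftarrow>gs'. g x * h y)" by blast
  then show ?case by (intro exI[of _ "gs @ gs'"]) auto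
next
  case (mult f f')
  then obtain gs gs' where gs: "\<forall>(g, h) \<in> set gs. polynomial_function g"
    "\<forall>x y. f (x, y) = (\<Sum>(g, h)\<leftarrow>gs. g x * h y)" "\<forall>(g, h) \<in> set gs'. polynomial_function g"
    "\<forall>x y. f' (x, y) = (\<Sum>(g, h)\<leftarrow>gs'. g x * h y)" by blast
  let ?ms = "\<lambda>gs gs'. concat (map (\<lambda>(g, h). map (\<lambda>(g', h'). (\<lambda>x. g x * g' x, \<lambda>y. h y * h' y)) gs') gs)
    :: (('a \<Rightarrow> real) \<times> ('b \<Rightarrow> real)) list"
  have 1: "(\<Sum>(a, b)\<leftarrow>map (\<lambda>(g', h'). (\<lambda>x. g x * g' x, \<lambda>y. h y * h' y)) gs'. a x * b y)
      = g x * h y * (\<Sum>(g', h')\<leftarrow>gs'. g' x * h' y)" for x y g h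
    by (induction gs') (auto simp: algebra_simps)
  have 2: "(\<Sum>(g, h)\<leftarrow>?ms gs gs'. g x * h y)
      = (\<Sum>(g, h)\<leftarrow>gs. g x * h y) * (\<Sum>(g, h)\<leftarrow>gs'. g x * h y)" for x y
  proof (induction gs)
    case Nil
    show ?case by simp
  next
    case (Cons a gs)
    show ?case
      using Cons 1 by (cases a) (simp add: distrib_right del: map_map)
  qed
  have 3: "\<forall>(g, h) \<in> set (?ms gs gs'). polynomial_function g"
    using gs(1,3) by (auto intro!: polynomial_function_real_mult) 
  show ?case using gs(2,4) 2 3 by (intro exI[of _ "?ms gs gs'"]) (simp only: simp_thms)
qed

text \<open>
  A finite-dimensional space of functions is separated from zero by finitely many points. By induction
  on the number of generators: modulo the combinations that vanish everywhere, adding \<open>h\<close>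
  enlarges the space of combinations that vanish on the test set by at most one dimension, so at most
  one more test point \<open>y\<close> is needed.
\<close>
lemma finite_test_set:
  fixes hs :: "('b \<Rightarrow> real) list"
  shows "\<exists>Y. finite Y \<and> (\<forall>c. length c = length hs \<longrightarrow>
    (\<forall>y\<in>Y. (\<Sum>(a, h)\<leftarrow>zip c hs. a * h y) = 0) \<longrightarrow> (\<forall>y. (\<Sum>(a, h)\<leftarrow>zip c hs. a * h y) = 0))"
proof (induction hs)
  case Nil
  show ?case by auto
next
  case (Cons h hs)
  let ?v = "\<lambda>c y. \<Sum>(a, h)\<leftarrow>zip c hs. a * h y"
  from Cons obtain Y where Y: "finite Y"
    "\<And>c y. length c = length hs \<Longrightarrow> \<forall>y\<in>Y. ?v c y = 0 \<Longrightarrow> ?v c y = 0" by blast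
  show ?case
  proof (cases "\<exists>a c y. length c = length hs \<and> (\<forall>y\<in>Y. a * h y + ?v c y = 0) \<and> a * h y + ?v c y \<noteq> 0")
    case False
    show ?thesis
    proof (intro exI[of _ Y] conjI allI impI)
      fix c y assume "length c = length (h # hs)" "\<forall>y\<in>Y. (\<Sum>(a, h)\<leftarrow>zip c (h # hs). a * h y) = 0"
      moreover from this obtain a c' where "c = a # c'" by (auto simp: length_Suc_conv)
      ultimately show "(\<Sum>(a, h)\<leftarrow>zip c (h # hs). a * h y) = 0" using False by simp blast
    qed (rule Y(1))
  next
    case True
    then obtain a c y where ac: "length c = length hs" "\<And>y. y \<in> Y \<Longrightarrow> a * h y + ?v c y = 0"
      "a * h y + ?v c y \<noteq> 0" by blast
    have "a \<noteq> 0" using Y(2)[OF ac(1)] ac(2,3) by force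
    have "a' * h z + ?v c' z = 0"
      if c': "length c' = length hs" "\<forall>z\<in>insert y Y. a' * h z + ?v c' z = 0" for a' c' z
    proof -
      (* Subtracting r times the witness combination removes h, so the induction hypothesis applies. *)
      define r where "r = a' / a"
      let ?d = "map2 (\<lambda>s t. s - r * t) c' c"
      have d: "?v ?d z = ?v c' z - r * ?v c z" for z
        using trans[OF c'(1) ac(1)[symmetric]] ac(1)
      proof (induction c' c hs rule: list_induct3)
        case Nil
        show ?case by simp
      next
        case (Cons x xs y ys z zs)
        then show ?case by (simp add: algebra_simps)
      qed
      have *: "?v ?d z + r * (a * h z + ?v c z) = a' * h z + ?v c' z" for z
        using \<open>a \<noteq> 0\<close> unfolding d by (simp add: r_def field_simps)
      have "?v ?d z = 0" for z
      proof (rule Y(2))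
        show "length ?d = length hs" using c' ac(1) by simp
        show "\<forall>z\<in>Y. ?v ?d z = 0"
        proof
          fix z assume "z \<in> Y"
          then have "a' * h z + ?v c' z = 0" "a * h z + ?v c z = 0" using c'(2) ac(2) by blast+
          with *[of z] have "?v ?d z + r * 0 = 0" by (simp only:)
          then show "?v ?d z = 0" by (simp only: mult_zero_right add_0_right)
        qed
      qed
      then have 0: "r * (a * h z + ?v c z) = a' * h z + ?v c' z" for z
        using *[of z] by (simp only: add_0_left)
      have "r * (a * h y + ?v c y) = 0" using c'(2) unfolding 0 by blast
      then have "r = 0" using ac(3) by (simp only: mult_eq_0_iff) blast
      then show ?thesis using 0[of z] by (simp only: mult_zero_left)
    qed
    note rule = this
    show ?thesis
    proof (intro exI[of _ "insert y Y"] conjI allI impI)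
      fix c z assume "length c = length (h # hs)"
        "\<forall>y\<in>insert y Y. (\<Sum>(a, h)\<leftarrow>zip c (h # hs). a * h y) = 0"
      moreover from this obtain a c' where "c = a # c'" by (auto simp: length_Suc_conv)
      ultimately show "(\<Sum>(a, h)\<leftarrow>zip c (h # hs). a * h z) = 0"
        using rule[of c' a z] by simp
    qed (simp add: Y(1))
  qed
qed

text \<open>
  Projection reduces to finitely many evaluations: the functions \<open>f (x, _)\<close> all lie in one
  finite-dimensional space, so finitely many test points \<open>y\<close>, independent of \<open>x\<close>, decide whether such a
  function is zero.
\<close>
lemma semialgebraic_ex_nonzero:
  fixes f :: "'a::euclidean_space \<times> 'b::euclidean_space \<Rightarrow> real"
  assumes "polynomial_function f"
  shows "semialgebraic {x. \<exists>y. f (x, y) \<noteq> 0}"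
proof -
  from polynomial_function_separated[of f] assms obtain gs where
    gs: "\<forall>(g, h) \<in> set gs. polynomial_function g" "\<And>x y. f (x, y) = (\<Sum>(g, h)\<leftarrow>gs. g x * h y)"
    by (auto simp: real_polynomial_function_eq)
  obtain Y where Y: "finite Y" and Y': "\<And>c. length c = length (map snd gs) \<Longrightarrow>
     \<forall>y\<in>Y. (\<Sum>(a, h)\<leftarrow>zip c (map snd gs). a * h y) = 0 \<Longrightarrow>
     \<forall>y. (\<Sum>(a, h)\<leftarrow>zip c (map snd gs). a * h y) = 0" using finite_test_set by metis
  have f: "f (x, y) = (\<Sum>(a, h)\<leftarrow>zip (map (\<lambda>g. fst g x) gs) (map snd gs). a * h y)" for x y
    unfolding gs by (simp add: zip_map_map zip_same_conv_map o_def case_prod_unfold)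
  have "(\<exists>y. f (x, y) \<noteq> 0) \<longleftrightarrow> (\<exists>y\<in>Y. f (x, y) \<noteq> 0)" for x
    using Y'[of "map (\<lambda>g. fst g x) gs"] unfolding f by auto
  moreover have "semialgebraic {x. \<exists>y\<in>Y. f (x, y) \<noteq> 0}"
  proof (intro semialgebraic_bex Y semialgebraic_not semialgebraic_eq polynomial_function_const)
    fix y
    show "polynomial_function (\<lambda>x. f (x, y))"
      by (rule polynomial_function_comp2[OF assms]) (intro polynomial_function_intros)
  qed
  ultimately show ?thesis by simp
qed

text \<open>
  The unknown \<open>y\<close> is subject to linear equations with polynomial coefficients, which are removed one at a
  time. Where \<open>l x \<noteq> 0\<close>, the hyperplane \<open>l x \<bullet> y = 0\<close> is parametrised polynomially by the multiple
  \<open>w \<mapsto> (l \<bullet> l) w - (l \<bullet> w) l\<close> of the orthogonal projection, which avoids any division. This map is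
  self-adjoint, so the remaining equations are again of the form treated by the induction hypothesis.
\<close>
lemma semialgebraic_ex_orthogonal:
  fixes f :: "'a::euclidean_space \<times> 'b::euclidean_space \<Rightarrow> real"
  assumes "\<forall>l\<in>set ls. polynomial_function l" and "polynomial_function f"
  shows "semialgebraic {x. \<exists>y. (\<forall>l\<in>set ls. l x \<bullet> y = 0) \<and> f (x, y) \<noteq> 0}"
  using assms
proof (induction "length ls" arbitrary: ls f)
  case 0
  then show ?case using semialgebraic_ex_nonzero by simp
next
  case (Suc k)
  then obtain l ls' where ls: "ls = l # ls'" and k: "k = length ls'" by (cases ls) auto
  define P where "P x w = (l x \<bullet> l x) *\<^sub>R w - (l x \<bullet> w) *\<^sub>R l x" for x w
  have l: "polynomial_function l" and ls': "\<forall>l\<in>set ls'. polynomial_function l"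
    using Suc.prems(1) ls by auto
  have 1: "semialgebraic {x. \<exists>y. (\<forall>l\<in>set ls'. l x \<bullet> y = 0) \<and> f (x, y) \<noteq> 0}"
    using Suc.hyps(1)[OF k] ls' Suc.prems(2) by blast
  let ?ls = "map (\<lambda>l' x. P x (l' x)) ls'" and ?f = "\<lambda>(x, w). f (x, P x w)"
  have 2: "semialgebraic {x. \<exists>w. (\<forall>l\<in>set ?ls. l x \<bullet> w = 0) \<and> ?f (x, w) \<noteq> 0}"
  proof (rule Suc.hyps(1))
    show "k = length ?ls" using k by simp
    show "\<forall>l\<in>set ?ls. polynomial_function l"
      using ls' l by (auto simp: P_def intro!: polynomial_function_intros)
    have "polynomial_function (\<lambda>p. f (fst p, P (fst p) (snd p)))"
      unfolding P_def
      by (intro polynomial_function_comp2[OF Suc.prems(2)] polynomial_function_intros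
          polynomial_function_comp2[OF l])
    then show "polynomial_function ?f" by (simp add: case_prod_unfold)
  qed
  have sym: "P x v \<bullet> w = v \<bullet> P x w" for x v w
    by (simp add: P_def inner_diff_left inner_diff_right inner_commute mult.commute)
  have orth: "l x \<bullet> P x w = 0" for x w
    by (simp add: P_def inner_diff_right)
  have scale: "y = P x (y /\<^sub>R (l x \<bullet> l x))" if "l x \<bullet> y = 0" "l x \<noteq> 0" for x y
    using that by (simp add: P_def)
  have "(\<exists>y. (\<forall>l\<in>set ls. l x \<bullet> y = 0) \<and> f (x, y) \<noteq> 0) \<longleftrightarrow>
     (l x = 0 \<and> (\<exists>y. (\<forall>l\<in>set ls'. l x \<bullet> y = 0) \<and> f (x, y) \<noteq> 0)) \<or>
     (\<not> l x = 0 \<and> (\<exists>w. (\<forall>l\<in>set ?ls. l x \<bullet> w = 0) \<and> ?f (x, w) \<noteq> 0))" for x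
  proof (cases "l x = 0")
    case False
    have "(\<exists>y. (\<forall>l\<in>set ls. l x \<bullet> y = 0) \<and> f (x, y) \<noteq> 0) \<longleftrightarrow>
        (\<exists>w. (\<forall>l\<in>set ls. l x \<bullet> P x w = 0) \<and> f (x, P x w) \<noteq> 0)"
      using scale False ls by (metis list.set_intros(1))
    then show ?thesis using False by (simp add: ls orth sym)
  qed (simp add: ls)
  then show ?case
    using semialgebraic_disj[OF
        semialgebraic_conj[OF semialgebraic_eq[OF l polynomial_function_const] 1]
        semialgebraic_conj[OF semialgebraic_not[OF semialgebraic_eq[OF l polynomial_function_const]] 2]]
    by simp
qed

text \<open>
  The coordinate-free form: each coordinate of \<open>L x y\<close> is the inner product of \<open>y\<close> with a vector that
  depends polynomially on \<open>x\<close>.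
\<close>
lemma semialgebraic_ex_linear:
  fixes f :: "'a::euclidean_space \<times> 'b::euclidean_space \<Rightarrow> real"
    and L :: "'a \<Rightarrow> 'b \<Rightarrow> 'c::euclidean_space"
  assumes lin: "\<And>x. linear (L x)" and L: "\<And>y. polynomial_function (\<lambda>x. L x y)"
    and f: "polynomial_function f"
  shows "semialgebraic {x. \<exists>y. L x y = 0 \<and> f (x, y) \<noteq> 0}"
proof -
  obtain bs :: "'c list" where bs: "set bs = Basis" using finite_list[OF finite_Basis] by blast
  define l where "l b x = (\<Sum>c\<in>Basis. (L x c \<bullet> b) *\<^sub>R c)" for b x
  have l: "l b x \<bullet> y = L x y \<bullet> b" for b x y
  proof -
    have "L x y = (\<Sum>c\<in>Basis. (y \<bullet> c) *\<^sub>R L x c)"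
      by (subst euclidean_representation[of y, symmetric])
        (simp add: linear_sum[OF lin] linear_cmul[OF lin])
    then show ?thesis
      by (simp add: l_def inner_sum_left inner_sum_right inner_commute[of _ y] mult.commute)
  qed
  have "semialgebraic {x. \<exists>y. (\<forall>l\<in>set (map l bs). l x \<bullet> y = 0) \<and> f (x, y) \<noteq> 0}"
    using f by (intro semialgebraic_ex_orthogonal)
      (auto simp: l_def intro!: polynomial_function_intros polynomial_function_sum L)
  moreover have "(\<forall>l\<in>set (map l bs). l x \<bullet> y = 0) \<longleftrightarrow> L x y = 0" for x y
    using euclidean_all_zero_iff[of "L x y"] by (simp add: bs l)
  ultimately show ?thesis by simp
qed

section \<open>Spectral theorem for Hermitian matrices\<close>

definition herm_inner :: "complex^'n::finite \<Rightarrow> complex^'n \<Rightarrow> complex" where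
  "herm_inner v w = (\<Sum>i\<in>UNIV. cnj (v $ i) * w $ i)"

lemma herm_inner_diff: "herm_inner v (w - w') = herm_inner v w - herm_inner v w'" "herm_inner (v - v') w = herm_inner v w - herm_inner v' w"
  by (simp_all add: herm_inner_def left_diff_distrib right_diff_distrib sum_subtractf)

lemma herm_inner_scale: "herm_inner v (c *s w) = c * herm_inner v w" "herm_inner (c *s v) w = cnj c * herm_inner v w"
  by (simp_all add: herm_inner_def sum_distrib_left mult_ac)

lemma herm_inner_cnj: "cnj (herm_inner v w) = herm_inner w v"
  by (simp add: herm_inner_def mult.commute)

lemma herm_inner_self: "herm_inner v v = of_real ((norm v)\<^sup>2)"
  unfolding herm_inner_def by (rule sum_cnj_self)

lemma herm_inner_ctranspose: "herm_inner v (ctranspose A *v w) = herm_inner (A *v v) w"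
  unfolding herm_inner_def by (rule ctranspose_adjoint)

lemma positive_definite_herm_inner:
  "positive_definite X \<longleftrightarrow> ctranspose X = X \<and> (\<forall>v. v \<noteq> 0 \<longrightarrow> 0 < Re (herm_inner v (X *v v)))"
  unfolding positive_definite_def quadratic_form_eq herm_inner_def ..

text \<open>
  If \<open>k \<notin> J\<close>, the vectors \<open>v j\<close> with \<open>j \<in> J\<close> are fewer than the dimension: the square matrix with rows
  \<open>(v j)\<^sup>*\<close> and zero rows elsewhere is singular.
\<close>
lemma exists_orthogonal_vector:
  fixes v :: "'n::finite \<Rightarrow> complex^'n"
  assumes "k \<notin> J"
  shows "\<exists>w. norm w = 1 \<and> (\<forall>j\<in>J. herm_inner (v j) w = 0)"
proof -
  let ?N = "\<chi> i. if i \<in> J then (\<chi> l. cnj (v i $ l)) else 0"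
  have "row k ?N = 0" using assms by (simp add: row_def vec_eq_iff)
  then have "det ?N = 0" by (rule det_zero_row)
  then obtain w where w: "w \<noteq> 0" "?N *v w = 0" using det_eq_0_iff_kernel by blast
  let ?w = "complex_of_real (inverse (norm w)) *s w"
  have "herm_inner (v j) w = (?N *v w) $ j" if "j \<in> J" for j
    using that by (simp add: matrix_vector_mult_def herm_inner_def)
  then have 0: "herm_inner (v j) w = 0" if "j \<in> J" for j using that w(2) by simp
  have "?w = inverse (norm w) *\<^sub>R w"
    by (simp add: vec_eq_iff scaleR_conv_of_real[of _ "_ :: complex"])
  then have "norm ?w = 1" using w(1) by simp
  then show ?thesis using 0 by (intro exI[of _ ?w]) (simp add: herm_inner_scale)
qed

lemma continuous_herm_inner: "continuous_on S (\<lambda>w. herm_inner v w)"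
  unfolding herm_inner_def by (intro continuous_intros)

text \<open>
  The orthogonal complement \<open>W\<close> of some eigenvectors is invariant, and a maximiser \<open>w\<close> of the Rayleigh
  quotient on the unit sphere of \<open>W\<close> is an eigenvector with eigenvalue \<open>q w\<close>: otherwise moving \<open>w\<close> along
  the negative of the residual \<open>z = q(w) w - X w\<close> would increase the quotient.
\<close>
lemma exists_eigenvector_orthogonal:
  fixes X :: "'n::finite cmat" and v :: "'n \<Rightarrow> complex^'n"
  assumes herm: "ctranspose X = X" and "k \<notin> J"
    and eig: "\<And>j. j \<in> J \<Longrightarrow> X *v v j = of_real (d j) *s v j"
  shows "\<exists>w r. norm w = 1 \<and> (\<forall>j\<in>J. herm_inner (v j) w = 0) \<and> X *v w = of_real r *s w"
proof -
  define W where "W = {w. \<forall>j\<in>J. herm_inner (v j) w = 0}"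
  define q where "q w = Re (herm_inner w (X *v w))" for w
  have sa: "herm_inner a (X *v b) = herm_inner (X *v a) b" for a b
    using herm_inner_ctranspose[of a X b] herm by simp
  have "closed W"
  proof -
    have "W = (\<Inter>j\<in>J. {w. herm_inner (v j) w = 0})" by (auto simp: W_def)
    then show ?thesis
      by (auto intro!: closed_INT closed_Collect_eq continuous_herm_inner continuous_on_const)
  qed
  then have comp: "compact (sphere 0 1 \<inter> W)" by (simp add: compact_Int_closed)
  have ne: "sphere 0 1 \<inter> W \<noteq> {}"
    using exists_orthogonal_vector[OF assms(2), of v] by (auto simp: W_def)
  have "continuous_on (sphere 0 1 \<inter> W) q"
    unfolding q_def herm_inner_def matrix_vector_mult_def by (intro continuous_intros)
  from continuous_attains_sup[OF comp ne this] obtain w where w: "norm w = 1" "w \<in> W"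
    and max: "\<And>u. norm u = 1 \<Longrightarrow> u \<in> W \<Longrightarrow> q u \<le> q w" by auto
  have sc: "complex_of_real r *s u = r *\<^sub>R u" for r and u :: "complex^'n"
    by (simp add: vec_eq_iff scaleR_conv_of_real[of _ "_ :: complex"])
  have Wsc: "c *s u \<in> W" if "u \<in> W" for c u using that by (auto simp: W_def herm_inner_scale)
  have Wdiff: "u - u' \<in> W" if "u \<in> W" "u' \<in> W" for u u' using that by (auto simp: W_def herm_inner_diff)
  have WX: "X *v u \<in> W" if "u \<in> W" for u
    using that by (auto simp: W_def sa eig herm_inner_scale)
  have qsc: "q (of_real r *s u) = r\<^sup>2 * q u" for r u
    by (simp add: q_def vector_scalar_commute herm_inner_scale power2_eq_square mult.assoc)
  define B where "B u = q w * (norm u)\<^sup>2 - q u" for u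
  have B_nonneg: "0 \<le> B u" if u: "u \<in> W" for u
  proof (cases "u = 0")
    case False
    let ?u = "of_real (inverse (norm u)) *s u"
    have "norm ?u = 1" using False by (simp only: sc) simp
    then have "q ?u \<le> q w" using max Wsc u by blast
    then show ?thesis using False by (simp only: qsc) (simp add: B_def field_simps)
  qed (simp add: B_def q_def herm_inner_def)
  define z where "z = of_real (q w) *s w - X *v w"
  have z: "z \<in> W" unfolding z_def using w by (intro Wdiff Wsc WX)
  have B_quad: "B (w - of_real t *s z) = t\<^sup>2 * B z - 2 * t * (norm z)\<^sup>2" for t
  proof -
    have n: "(norm u)\<^sup>2 = Re (herm_inner u u)" for u :: "complex^'n" by (simp add: herm_inner_self)
    have B: "B u = Re (herm_inner u (of_real (q w) *s u - X *v u))" for u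
      by (simp add: B_def q_def herm_inner_diff herm_inner_scale n)
    have Bw: "B w = 0" using w by (simp add: B_def)
    have "herm_inner w (of_real (q w) *s z - X *v z) = herm_inner (of_real (q w) *s w - X *v w) z"
      by (simp add: herm_inner_diff herm_inner_scale sa)
    also have "\<dots> = herm_inner z z" unfolding z_def[symmetric] ..
    finally have "herm_inner w (of_real (q w) *s z - X *v z) = herm_inner z z" .
    then have 1: "Re (herm_inner w (of_real (q w) *s z - X *v z)) = (norm z)\<^sup>2" by (simp add: herm_inner_self)
    have 2: "Re (herm_inner z (of_real (q w) *s w - X *v w)) = (norm z)\<^sup>2"
      unfolding z_def[symmetric] by (simp add: herm_inner_self)
    have "B (w - of_real t *s z) = B w - t * Re (herm_inner w (of_real (q w) *s z - X *v z))
        - t * Re (herm_inner z (of_real (q w) *s w - X *v w)) + t\<^sup>2 * B z"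
      unfolding B
      by (simp add: herm_inner_diff herm_inner_scale vector_scalar_commute matrix_vector_mult_diff_distrib)
        (simp add: algebra_simps power2_eq_square)
    then show ?thesis unfolding Bw 1 2 by simp
  qed
  have "0 \<le> t\<^sup>2 * B z - 2 * t * (norm z)\<^sup>2" for t
    using B_nonneg[OF Wdiff[OF w(2) Wsc[OF z]]] unfolding B_quad[symmetric] .
  note pos = this
  have "z = 0"
  proof (rule ccontr)
    assume "z \<noteq> 0"
    then have nz: "0 < (norm z)\<^sup>2" by simp
    show False
    proof (cases "B z = 0")
      case True
      then show False using pos[of 1] nz by simp
    next
      case False
      then have "0 < B z" using B_nonneg[OF z] by simp
      then have "((norm z)\<^sup>2 / B z)\<^sup>2 * B z - 2 * ((norm z)\<^sup>2 / B z) * (norm z)\<^sup>2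
          = - ((norm z)\<^sup>2 * (norm z)\<^sup>2 / B z)"
        by (simp add: field_simps power2_eq_square)
      (* This value of t minimises the quadratic polynomial on the right of B_quad. *)
      with pos[of "(norm z)\<^sup>2 / B z"] have "(norm z)\<^sup>2 * (norm z)\<^sup>2 / B z \<le> 0" by linarith
      moreover have "0 < (norm z)\<^sup>2 * (norm z)\<^sup>2 / B z"
        using nz \<open>0 < B z\<close> by simp
      ultimately show False by linarith
    qed
  qed
  then show ?thesis
    using w by (intro exI[of _ w] exI[of _ "q w"]) (auto simp: z_def W_def)
qed

definition diag :: "('n::finite \<Rightarrow> real) \<Rightarrow> 'n cmat" where
  "diag d = (\<chi> i j. if i = j then of_real (d i) else 0)"

lemma diag_mult_entry: "(diag d ** M) $ i $ j = of_real (d i) * M $ i $ j"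
proof -
  have "(diag d ** M) $ i $ j = (\<Sum>k\<in>UNIV. if k = i then of_real (d i) * M $ k $ j else 0)"
    unfolding matrix_matrix_mult_def diag_def
    by (simp only: vec_lambda_beta) (rule sum.cong; simp)
  then show ?thesis by simp
qed

lemma mult_diag_entry: "(M ** diag d) $ i $ j = M $ i $ j * of_real (d j)"
proof -
  have "(M ** diag d) $ i $ j = (\<Sum>k\<in>UNIV. if k = j then M $ i $ k * of_real (d j) else 0)"
    unfolding matrix_matrix_mult_def diag_def
    by (simp only: vec_lambda_beta) (rule sum.cong; simp)
  then show ?thesis by simp
qed

lemma diag_mult_vector_entry: "(diag d *v u) $ i = of_real (d i) * u $ i"
proof -
  have "(diag d *v u) $ i = (\<Sum>k\<in>UNIV. if k = i then of_real (d i) * u $ k else 0)"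
    unfolding matrix_vector_mult_def diag_def
    by (simp only: vec_lambda_beta) (rule sum.cong; simp)
  then show ?thesis by simp
qed

text \<open>
  The family is indexed by a subset \<open>J\<close> of the matrix index type, so that induction on \<open>J\<close> builds an
  orthonormal eigenbasis without any ordering of the indices.
\<close>
lemma hermitian_orthonormal_eigenvectors:
  fixes X :: "'n::finite cmat" and J :: "'n set"
  assumes herm: "ctranspose X = X"
  shows "\<exists>v d. \<forall>i\<in>J. X *v v i = of_real (d i) *s v i \<and>
    (\<forall>j\<in>J. herm_inner (v i) (v j) = (if i = j then 1 else 0))"
  using finite[of J]
proof induction
  case empty
  show ?case by simp
next
  case (insert k J)
  then obtain v d where v: "\<forall>i\<in>J. X *v v i = of_real (d i) *s v i \<and>
    (\<forall>j\<in>J. herm_inner (v i) (v j) = (if i = j then 1 else 0))" by blast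
  from exists_eigenvector_orthogonal[OF herm insert(2), of v d] v
  obtain w r where w: "norm w = 1" "\<forall>j\<in>J. herm_inner (v j) w = 0" "X *v w = of_real r *s w" by blast
  have w': "herm_inner w (v j) = 0" if "j \<in> J" for j
    using w(2) that herm_inner_cnj[of "v j" w] by simp
  have ww: "herm_inner w w = 1" using w(1) by (simp add: herm_inner_self)
  show ?case
    using v w insert(2) w' ww by (intro exI[of _ "v(k := w)"] exI[of _ "d(k := r)"]) auto
qed

lemma unitaryI: "ctranspose U ** U = mat 1 \<Longrightarrow> unitary U"
  using matrix_left_right_inverse[of "ctranspose U" U] unfolding unitary_def by blast

lemma spectral_theorem:
  fixes X :: "'n::finite cmat"
  assumes "ctranspose X = X"
  obtains U d where "unitary U" "X = U ** diag d ** ctranspose U"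
proof -
  from hermitian_orthonormal_eigenvectors[OF assms, of UNIV]
  obtain v :: "'n \<Rightarrow> complex^'n" and d :: "'n \<Rightarrow> real" where
    "\<forall>i\<in>UNIV. X *v v i = of_real (d i) *s v i \<and>
      (\<forall>j\<in>UNIV. herm_inner (v i) (v j) = (if i = j then 1 else 0))" by blast
  then have v: "X *v v i = of_real (d i) *s v i" "herm_inner (v i) (v j) = (if i = j then 1 else 0)"
    for i j by simp_all
  define U :: "'n cmat" where "U = (\<chi> i j. v j $ i)"
  have "ctranspose U ** U = mat 1"
    using v(2) by (simp add: vec_eq_iff matrix_matrix_mult_def ctranspose_def U_def mat_def herm_inner_def)
  then have U: "unitary U" by (rule unitaryI)
  have "X ** U = U ** diag d"
    using v(1) by (simp add: vec_eq_iff mult_diag_entry mult.commute)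
      (simp add: matrix_matrix_mult_def U_def matrix_vector_mult_def mult.commute)
  then have "X ** (U ** ctranspose U) = U ** diag d ** ctranspose U"
    by (simp add: matrix_mul_assoc)
  then show ?thesis using U that by (simp add: unitary_def)
qed

lemma diag_mult: "diag d ** diag e = diag (\<lambda>i. d i * e i)"
  by (simp add: vec_eq_iff diag_mult_entry) (simp add: diag_def)

lemma ctranspose_diag: "ctranspose (diag d) = diag d"
  by (simp add: vec_eq_iff ctranspose_def diag_def)

lemma diag_one: "diag (\<lambda>i. 1) = mat 1"
  by (simp add: vec_eq_iff diag_def mat_def)

lemma unitary_cancel:
  assumes "unitary U"
  shows "ctranspose U ** (U ** M) = M" "U ** (ctranspose U ** M) = M"
  using assms by (simp_all add: matrix_mul_assoc unitary_def)

lemma det_diag: "det (diag d) = (\<Prod>i\<in>UNIV. of_real (d i))"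
  by (subst det_diagonal) (simp_all add: diag_def)

lemma positive_definite_spectral:
  fixes X :: "'n::finite cmat"
  assumes "unitary U" "X = U ** diag d ** ctranspose U"
  shows "positive_definite X \<longleftrightarrow> (\<forall>i. 0 < d i)"
proof -
  have herm: "ctranspose X = X"
    by (simp add: assms(2) ctranspose_mult ctranspose_diag matrix_mul_assoc)
  have "herm_inner v (X *v v) = of_real (\<Sum>i\<in>UNIV. d i * (cmod ((ctranspose U *v v) $ i))\<^sup>2)" for v
  proof -
    let ?u = "ctranspose U *v v"
    have "herm_inner v (X *v v) = herm_inner v (U *v (diag d *v ?u))"
      by (simp add: assms(2) matrix_vector_mul_assoc matrix_mul_assoc)
    also have "\<dots> = herm_inner ?u (diag d *v ?u)"
      using herm_inner_ctranspose[of v "ctranspose U"] by simp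
    also have "diag d *v ?u = (\<chi> i. of_real (d i) * ?u $ i)"
      by (simp add: vec_eq_iff diag_mult_vector_entry)
    also have "herm_inner ?u \<dots> = (\<Sum>i\<in>UNIV. of_real (d i) * (?u $ i * cnj (?u $ i)))"
      by (simp add: herm_inner_def mult_ac)
    also have "\<dots> = of_real (\<Sum>i\<in>UNIV. d i * (cmod (?u $ i))\<^sup>2)"
      by (simp only: complex_norm_square[symmetric] of_real_sum of_real_mult)
    finally show ?thesis .
  qed
  note quad = this
  show ?thesis
  proof
    assume pd: "positive_definite X"
    show "\<forall>i. 0 < d i"
    proof
      fix i
      let ?e = "axis i 1 :: complex^'n"
      have e: "ctranspose U *v (U *v ?e) = ?e"
        using assms(1) by (simp add: matrix_vector_mul_assoc unitary_def)
      then have "U *v ?e \<noteq> 0" by (metis axis_eq_0_iff matrix_vector_mult_0_right zero_neq_one)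
      then have "0 < Re (herm_inner (U *v ?e) (X *v (U *v ?e)))"
        using pd by (simp add: positive_definite_herm_inner)
      then show "0 < d i"
        unfolding quad e by (simp add: axis_def if_distrib[of "\<lambda>c. _ * (cmod c)\<^sup>2"] cong: if_cong)
    qed
  next
    assume d: "\<forall>i. 0 < d i"
    have "0 < Re (herm_inner v (X *v v))" if "v \<noteq> 0" for v
    proof -
      have "U *v (ctranspose U *v v) = v"
        using assms(1) by (simp add: matrix_vector_mul_assoc unitary_def)
      then have "ctranspose U *v v \<noteq> 0" using that by auto
      then obtain i where "(ctranspose U *v v) $ i \<noteq> 0" by (auto simp: vec_eq_iff)
      then show ?thesis
        unfolding quad Re_complex_of_real using d
        by (intro sum_pos2[of _ i]) (simp_all add: less_imp_le)
    qed
    then show "positive_definite X" using herm by (simp add: positive_definite_herm_inner)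
  qed
qed

lemma positive_definite_gram:
  fixes S :: "'n::finite cmat"
  assumes "invertible S"
  shows "positive_definite (ctranspose S ** S)"
proof -
  have "positive_definite (mat 1 :: 'n cmat)"
    using positive_definite_spectral[of "mat 1" "mat 1" "\<lambda>i. 1"]
    by (simp add: diag_one unitary_one)
  from positive_definite_congruence[OF this assms] show ?thesis by simp
qed

text \<open>
  The square root commutes with everything that commutes with \<open>P\<close>: in an eigenbasis, commuting with a
  diagonal matrix only means vanishing of the entries between different eigenvalues. This is the property
  that makes polar decomposition compatible with intertwiners.
\<close>
lemma positive_definite_sqrt:
  fixes P :: "'n::finite cmat"
  assumes "positive_definite P"
  obtains H where "ctranspose H = H" "H ** H = P" "invertible H"
    "\<And>M. P ** M = M ** P \<Longrightarrow> H ** M = M ** H"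
proof -
  have "ctranspose P = P" using assms by (simp add: positive_definite_def)
  then obtain U d where U: "unitary U" and P: "P = U ** diag d ** ctranspose U"
    by (rule spectral_theorem)
  have d: "0 < d i" for i using assms positive_definite_spectral[OF U P] by simp
  define s where "s i = sqrt (d i)" for i
  define H where "H = U ** diag s ** ctranspose U"
  have ss: "s i * s i = d i" "s i \<noteq> 0" for i using d[of i] by (auto simp: s_def)
  have "ctranspose H = H"
    by (simp add: H_def ctranspose_mult ctranspose_diag matrix_mul_assoc)
  moreover have "H ** H = P"
    by (simp add: H_def P matrix_mul_assoc[symmetric] unitary_cancel[OF U])
      (simp add: matrix_mul_assoc diag_mult ss)
  moreover have "invertible H"
  proof -
    have "invertible (diag s)"
      using ss(2) by (simp add: invertible_det_nz det_diag)
    then show ?thesis unfolding H_def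
      by (intro invertible_mult unitary_invertible[OF U]
          unitary_invertible[OF unitary_ctranspose[OF U]])
  qed
  moreover have "H ** M = M ** H" if M: "P ** M = M ** P" for M
  proof -
    define N where "N = ctranspose U ** M ** U"
    have "diag d ** N = ctranspose U ** (P ** M) ** U"
      by (simp add: N_def P matrix_mul_assoc[symmetric] unitary_cancel[OF U])
    also have "\<dots> = N ** diag d"
      unfolding M using U
      by (simp add: N_def P matrix_mul_assoc[symmetric] unitary_def)
    finally have *: "diag d ** N = N ** diag d" .
    have "of_real (d i) * N $ i $ j = N $ i $ j * of_real (d j)" for i j
    proof -
      have "(diag d ** N) $ i $ j = (N ** diag d) $ i $ j" using * by simp
      then show ?thesis by (simp add: diag_mult_entry mult_diag_entry)
    qed
    then have "N $ i $ j = 0 \<or> d i = d j" for i j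
      by (metis mult.commute mult_cancel_left of_real_eq_iff)
    then have "diag s ** N = N ** diag s"
      by (auto simp: vec_eq_iff diag_mult_entry mult_diag_entry s_def mult.commute)
    then have "U ** (diag s ** N) ** ctranspose U = U ** (N ** diag s) ** ctranspose U" by simp
    then show ?thesis
      using U by (simp add: N_def H_def matrix_mul_assoc[symmetric] unitary_cancel[OF U] unitary_def)
  qed
  ultimately show ?thesis using that by blast
qed

lemma positive_definite_factor:
  assumes "positive_definite P"
  obtains S where "invertible S" "P = ctranspose S ** S"
  using positive_definite_sqrt[OF assms] by metis

section \<open>Semialgebraicity of positive definiteness and congruence\<close>

lemma polynomial_function_complex_iff:
  "polynomial_function (f :: 'a::real_normed_vector \<Rightarrow> complex) \<longleftrightarrow>
     polynomial_function (\<lambda>x. Re (f x)) \<and> polynomial_function (\<lambda>x. Im (f x))"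
  by (subst polynomial_function_iff_Basis_inner)
    (simp add: Basis_complex_def real_polynomial_function_eq)

lemma polynomial_function_complex_mult:
  fixes f g :: "'a::real_normed_vector \<Rightarrow> complex"
  assumes "polynomial_function f" "polynomial_function g"
  shows "polynomial_function (\<lambda>x. f x * g x)"
  using assms unfolding polynomial_function_complex_iff
  by (auto intro!: polynomial_function_intros)

lemma polynomial_function_cnj:
  "polynomial_function f \<Longrightarrow> polynomial_function (\<lambda>x. cnj (f x))"
  by (rule polynomial_function_bounded_linear_comp[OF bounded_linear_cnj])

lemma polynomial_function_nth:
  fixes f :: "'a::real_normed_vector \<Rightarrow> 'b::euclidean_space^'n::finite"
  shows "polynomial_function f \<Longrightarrow> polynomial_function (\<lambda>x. f x $ i)"
  by (rule polynomial_function_bounded_linear_comp[OF bounded_linear_vec_nth])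

lemma polynomial_function_vec:
  fixes f :: "'n::finite \<Rightarrow> 'a::real_normed_vector \<Rightarrow> 'b::euclidean_space"
  assumes "\<And>i. polynomial_function (f i)"
  shows "polynomial_function (\<lambda>x. \<chi> i. f i x)"
  using assms unfolding polynomial_function_iff_Basis_inner
  by (auto simp: Basis_vec_def inner_axis)

lemma polynomial_function_complex_prod:
  fixes f :: "'i \<Rightarrow> 'a::real_normed_vector \<Rightarrow> complex"
  assumes "\<And>i. polynomial_function (f i)"
  shows "polynomial_function (\<lambda>x. \<Prod>i\<in>I. f i x)"
  by (induction I rule: infinite_finite_induct)
    (simp_all add: polynomial_function_complex_mult assms)

lemma polynomial_function_matrix_mult:
  fixes f g :: "'a::real_normed_vector \<Rightarrow> 'n::finite cmat"
  assumes "polynomial_function f" "polynomial_function g"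
  shows "polynomial_function (\<lambda>x. f x ** g x)"
  unfolding matrix_matrix_mult_def
  using assms by (intro polynomial_function_vec polynomial_function_sum
      polynomial_function_complex_mult polynomial_function_nth) auto

lemma polynomial_function_ctranspose:
  fixes f :: "'a::real_normed_vector \<Rightarrow> 'n::finite cmat"
  assumes "polynomial_function f"
  shows "polynomial_function (\<lambda>x. ctranspose (f x))"
  unfolding ctranspose_def
  using assms by (intro polynomial_function_vec polynomial_function_cnj polynomial_function_nth)

lemma polynomial_function_det:
  fixes f :: "'a::real_normed_vector \<Rightarrow> 'n::finite cmat"
  assumes "polynomial_function f"
  shows "polynomial_function (\<lambda>x. det (f x))"
  unfolding det_def
  using assms by (intro polynomial_function_sum polynomial_function_complex_mult
      polynomial_function_complex_prod polynomial_function_nth polynomial_function_const)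
    (simp add: finite_permutations)

lemmas polynomial_function_matrix_intros =
  polynomial_function_matrix_mult polynomial_function_ctranspose polynomial_function_det

lemma polynomial_function_coeff_det:
  fixes M :: "'a::real_normed_vector \<Rightarrow> complex poly^'n::finite^'n"
  assumes M: "\<And>i j k. polynomial_function (\<lambda>x. coeff (M x $ i $ j) k)"
  shows "polynomial_function (\<lambda>x. coeff (det (M x)) k)"
proof -
  have mult: "polynomial_function (\<lambda>x. coeff (f x * g x) k)"
    if "\<And>k. polynomial_function (\<lambda>x. coeff (f x) k)" "\<And>k. polynomial_function (\<lambda>x. coeff (g x) k)"
    for f g :: "'a \<Rightarrow> complex poly" and k
    unfolding coeff_mult
    using that by (intro polynomial_function_sum polynomial_function_complex_mult) auto
  have prod: "polynomial_function (\<lambda>x. coeff (\<Prod>i\<in>I. f i x) k)"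
    if "\<And>i k. polynomial_function (\<lambda>x. coeff (f i x) k)"
    for f :: "'n \<Rightarrow> 'a \<Rightarrow> complex poly" and I k
  proof (induction I arbitrary: k rule: infinite_finite_induct)
    case (insert i I)
    then show ?case using mult[of "f i"] that by simp
  qed simp_all
  show ?thesis
    unfolding det_def coeff_sum
    by (intro polynomial_function_sum mult prod M polynomial_function_const)
      (simp add: finite_permutations)
qed

lemma polynomial_function_coeff_char_poly_mat:
  fixes f :: "'a::real_normed_vector \<Rightarrow> 'n::finite cmat"
  assumes "polynomial_function f"
  shows "polynomial_function (\<lambda>x. coeff (char_poly_mat (f x)) k)"
  unfolding char_poly_mat_def
proof (rule polynomial_function_coeff_det)
  fix i j k
  have "(\<lambda>x. coeff ((\<chi> i j. (if i = j then [:0, 1:] else 0) - [:f x $ i $ j:]) $ i $ j) k)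
      = (\<lambda>x. coeff (if i = j then [:0, 1:] else 0) k - (if k = 0 then f x $ i $ j else 0))"
    by (simp add: fun_eq_iff coeff_pCons split: nat.split)
  moreover have "polynomial_function \<dots>"
    using assms by (cases "k = 0") (auto intro!: polynomial_function_intros polynomial_function_nth)
  ultimately show "polynomial_function
    (\<lambda>x. coeff ((\<chi> i j. (if i = j then [:0, 1:] else 0) - [:f x $ i $ j:]) $ i $ j) k)" by simp
qed

lemma mat_mult_entry: "(mat z ** M) $ i $ j = z * M $ i $ j" for M :: "'n::finite cmat"
proof -
  have "(mat z ** M) $ i $ j = (\<Sum>k\<in>UNIV. if k = i then z * M $ k $ j else 0)"
    unfolding matrix_matrix_mult_def mat_def
    by (simp only: vec_lambda_beta) (rule sum.cong; simp)
  then show ?thesis by simp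
qed

lemma mat_mult_commute: "mat z ** M = M ** mat z" for M :: "'n::finite cmat"
proof -
  have "(M ** mat z) $ i $ j = z * M $ i $ j" for i j
  proof -
    have "(M ** mat z) $ i $ j = (\<Sum>k\<in>UNIV. if k = j then z * M $ i $ k else 0)"
      unfolding matrix_matrix_mult_def mat_def
      by (simp only: vec_lambda_beta) (rule sum.cong; simp)
    then show ?thesis by simp
  qed
  then show ?thesis by (simp add: vec_eq_iff mat_mult_entry)
qed

lemma matrix_diff_ldistrib: "M ** (N - K) = M ** N - M ** K" for M N K :: "'n::finite cmat"
  by (simp add: vec_eq_iff matrix_matrix_mult_def right_diff_distrib sum_subtractf)

lemma matrix_diff_rdistrib: "(N - K) ** M = N ** M - K ** M" for M N K :: "'n::finite cmat"
  by (simp add: vec_eq_iff matrix_matrix_mult_def left_diff_distrib sum_subtractf)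

lemma matrix_mult_minus:
  "M ** (- N) = - (M ** N)" "(- M) ** N = - (M ** N)" for M N :: "'n::finite cmat"
  by (simp_all add: vec_eq_iff matrix_matrix_mult_def sum_negf)

lemma char_poly_mat_spectral:
  fixes U :: "'n::finite cmat"
  assumes "unitary U"
  shows "char_poly_mat (U ** diag d ** ctranspose U) = (\<Prod>i\<in>UNIV. [:- of_real (d i), 1:])"
proof -
  have "poly (char_poly_mat (U ** diag d ** ctranspose U)) z
      = poly (\<Prod>i\<in>UNIV. [:- of_real (d i), 1:]) z" for z
  proof -
    have "U ** mat z ** ctranspose U = mat z ** (U ** ctranspose U)"
      by (simp add: mat_mult_commute[of z U] matrix_mul_assoc)
    then have "mat z - U ** diag d ** ctranspose U = U ** (mat z - diag d) ** ctranspose U"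
      using assms by (simp add: matrix_diff_ldistrib matrix_diff_rdistrib unitary_def)
    then have "det (mat z - U ** diag d ** ctranspose U)
        = det (U ** ctranspose U) * det (mat z - diag d)"
      by (simp add: det_mul)
    also have "\<dots> = det (mat z - diag d)" using assms by (simp add: unitary_def)
    also have "\<dots> = (\<Prod>i\<in>UNIV. z - of_real (d i))"
      by (subst det_diagonal) (simp_all add: diag_def mat_def)
    finally show ?thesis by (simp add: poly_char_poly_mat poly_prod)
  qed
  then show ?thesis by (simp add: poly_eq_poly_eq_iff[symmetric] fun_eq_iff)
qed

lemma coeff_prod_linear_nonneg:
  fixes d :: "'n \<Rightarrow> real"
  assumes "\<And>i. 0 \<le> d i"
  shows "0 \<le> Re (coeff (\<Prod>i\<in>I. [:of_real (d i), 1:] :: complex poly) k)"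
proof (induction I arbitrary: k rule: infinite_finite_induct)
  case (insert i I)
  then show ?case
    using assms by (cases k) simp_all
qed (simp_all add: coeff_1)

text \<open>
  Only the coefficients up to the degree are tested, so that the hypothesis is a finite condition.
  The leading coefficient is \<open>1\<close>, and so the value at \<open>t > 0\<close> is at least \<open>t\<close> to the power of the degree.
\<close>
lemma prod_linear_no_positive_root:
  fixes d :: "'n::finite \<Rightarrow> real"
  assumes "\<And>k. k \<le> CARD('n) \<Longrightarrow>
    0 \<le> Re (coeff (\<Prod>i\<in>UNIV. [:of_real (d i), 1:] :: complex poly) k)" and "0 < t"
  shows "poly (\<Prod>i\<in>UNIV. [:of_real (d i), 1:]) (complex_of_real t) \<noteq> 0"
proof -
  define p where "p = (\<Prod>i\<in>UNIV. [:of_real (d i), 1:] :: complex poly)"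
  have deg: "degree p = CARD('n)"
    unfolding p_def by (subst degree_prod_sum_eq) simp_all
  have lead: "coeff p (degree p) = 1"
    unfolding p_def lead_coeff_prod by simp
  have "0 \<le> Re (coeff p k)" if "k \<le> degree p" for k
    using assms(1)[of k] that unfolding deg by (simp only: p_def)
  then have "0 < (\<Sum>k\<le>degree p. Re (coeff p k) * t ^ k)"
    using assms(2) lead by (intro sum_pos2[of _ "degree p"]) auto
  also have "\<dots> = Re (poly p (of_real t))"
    by (simp add: poly_altdef flip: of_real_power)
  finally show ?thesis unfolding p_def by auto
qed

text \<open>
  The polynomial \<open>char_poly_mat (- X)\<close> has the value \<open>det (t + X)\<close> at \<open>t\<close>, so its roots are the negatives
  of the eigenvalues \<open>d i\<close> of \<open>X\<close>. Nonnegative coefficients exclude positive roots and the determinant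
  excludes the root \<open>0\<close>; conversely, if all \<open>d i\<close> are positive, the product of the \<open>t + d i\<close> has
  nonnegative coefficients.
\<close>
lemma positive_definite_iff_coeffs:
  fixes X :: "'n::finite cmat"
  shows "positive_definite X \<longleftrightarrow> ctranspose X = X \<and> det X \<noteq> 0 \<and>
    (\<forall>k\<in>{..CARD('n)}. 0 \<le> Re (coeff (char_poly_mat (- X)) k))"
proof (cases "ctranspose X = X")
  case True
  then obtain U d where U: "unitary U" and X: "X = U ** diag d ** ctranspose U"
    by (rule spectral_theorem)
  have "- X = U ** diag (\<lambda>i. - d i) ** ctranspose U"
  proof -
    have "diag (\<lambda>i. - d i) = - diag d" by (simp add: diag_def vec_eq_iff)
    then show ?thesis by (simp add: X matrix_mult_minus)
  qed
  then have char: "char_poly_mat (- X) = (\<Prod>i\<in>UNIV. [:of_real (d i), 1:])"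
    using char_poly_mat_spectral[OF U, of "\<lambda>i. - d i"] by simp
  have "det X = det (U ** ctranspose U) * det (diag d)" by (simp add: X det_mul)
  then have det: "det X = (\<Prod>i\<in>UNIV. of_real (d i))"
    using U by (simp add: unitary_def det_diag)
  show ?thesis
  proof
    assume "positive_definite X"
    then have d: "0 < d i" for i using positive_definite_spectral[OF U X] by simp
    then show "ctranspose X = X \<and> det X \<noteq> 0 \<and>
        (\<forall>k\<in>{..CARD('n)}. 0 \<le> Re (coeff (char_poly_mat (- X)) k))"
      using True coeff_prod_linear_nonneg[of d UNIV] less_imp_le[OF d]
      by (simp add: char det) (metis less_irrefl)
  next
    assume R: "ctranspose X = X \<and> det X \<noteq> 0 \<and>
        (\<forall>k\<in>{..CARD('n)}. 0 \<le> Re (coeff (char_poly_mat (- X)) k))"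
    have "0 < d i" for i
    proof (rule ccontr)
      assume "\<not> 0 < d i"
      moreover have "d i \<noteq> 0" using R by (auto simp: det)
      ultimately have "0 < - d i" by simp
      then have "poly (char_poly_mat (- X)) (of_real (- d i)) \<noteq> 0"
        unfolding char using R char by (intro prod_linear_no_positive_root) simp_all
      moreover have "poly (char_poly_mat (- X)) (of_real (- d i)) = 0"
        by (auto simp: char poly_prod intro!: prod_zero)
      ultimately show False by blast
    qed
    then show "positive_definite X" using positive_definite_spectral[OF U X] by simp
  qed
qed (simp add: positive_definite_def)

lemma semialgebraic_positive_definite: "semialgebraic {X :: 'n::finite cmat. positive_definite X}"
proof -
  have "polynomial_function (\<lambda>X :: 'n cmat. Re (coeff (char_poly_mat (- X)) k))" for k
    using polynomial_function_coeff_char_poly_mat[of "\<lambda>X :: 'n cmat. - X" k]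
    by (simp add: polynomial_function_complex_iff polynomial_function_minus)
  then show ?thesis
    unfolding positive_definite_iff_coeffs
    by (intro semialgebraic_conj semialgebraic_eq semialgebraic_not semialgebraic_ball
        semialgebraic_nonneg polynomial_function_matrix_intros polynomial_function_intros) auto
qed

lemma semialgebraic_pd_triples: "semialgebraic (pd_triples :: ('n::finite cmat \<times> 'n cmat \<times> 'n cmat) set)"
proof -
  have "pd_triples = {p :: 'n cmat \<times> 'n cmat \<times> 'n cmat. fst p \<in> {X. positive_definite X} \<and>
      fst (snd p) \<in> {X. positive_definite X} \<and> snd (snd p) \<in> {X. positive_definite X}}"
    by (auto simp: pd_triples_def)
  also have "semialgebraic \<dots>"
    by (intro semialgebraic_conj semialgebraic_vimage semialgebraic_positive_definite
        polynomial_function_intros)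
  finally show ?thesis .
qed

lemma semialgebraic_mult_triples:
  "semialgebraic (mult_triples :: ('n::finite cmat \<times> 'n cmat \<times> 'n cmat) set)"
proof -
  have "mult_triples = {p :: 'n cmat \<times> 'n cmat \<times> 'n cmat. det (fst p) \<noteq> 0 \<and> det (fst (snd p)) \<noteq> 0 \<and>
      det (snd (snd p)) \<noteq> 0 \<and> fst p ** fst (snd p) ** snd (snd p) = mat 1}"
    by (auto simp: mult_triples_def invertible_det_nz)
  also have "semialgebraic \<dots>"
    by (intro semialgebraic_conj semialgebraic_not semialgebraic_eq
        polynomial_function_matrix_intros polynomial_function_intros)
  finally show ?thesis .
qed

text \<open>
  The unitary factor \<open>U\<close> of the polar decomposition \<open>T = U H\<close> intertwines whatever pairs of Hermitian
  matrices \<open>T\<close> intertwines. Taking adjoints of \<open>T M = M' T\<close> gives \<open>M T\<^sup>* = T\<^sup>* M'\<close>, so \<open>T\<^sup>*T\<close> commutes with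
  \<open>M\<close>, and hence so does its square root \<open>H\<close>. One \<open>U\<close> serves all pairs, which is what simultaneous
  congruence needs.
\<close>
lemma unitary_of_similar_hermitian:
  fixes T :: "'n::finite cmat"
  assumes "invertible T"
  obtains U where "unitary U"
    "\<And>M M'. ctranspose M = M \<Longrightarrow> ctranspose M' = M' \<Longrightarrow> T ** M = M' ** T \<Longrightarrow> U ** M = M' ** U"
proof -
  obtain H where H: "ctranspose H = H" "H ** H = ctranspose T ** T" "invertible H"
    and comm: "\<And>M. (ctranspose T ** T) ** M = M ** (ctranspose T ** T) \<Longrightarrow> H ** M = M ** H"
    using positive_definite_sqrt[OF positive_definite_gram[OF assms]] by metis
  let ?K = "matrix_inv H"
  have K: "H ** ?K = mat 1" "?K ** H = mat 1" using matrix_inv_cancel[OF H(3)] by auto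
  have Kherm: "ctranspose ?K = ?K"
  proof -
    have "ctranspose ?K ** H = mat 1" using arg_cong[OF K(1), of ctranspose] H(1)
      by (simp add: ctranspose_mult)
    then show ?thesis by (metis K(1) matrix_mul_assoc matrix_mul_lid matrix_mul_rid)
  qed
  have "ctranspose (T ** ?K) ** (T ** ?K) = ?K ** (ctranspose T ** T) ** ?K"
    by (simp add: ctranspose_mult Kherm matrix_mul_assoc)
  also have "\<dots> = (?K ** H) ** (H ** ?K)" by (simp only: H(2)[symmetric] matrix_mul_assoc)
  finally have "unitary (T ** ?K)" by (intro unitaryI) (simp add: K)
  moreover have "(T ** ?K) ** M = M' ** (T ** ?K)"
    if M: "ctranspose M = M" "ctranspose M' = M'" and TM: "T ** M = M' ** T" for M M'
  proof -
    have TM': "M ** ctranspose T = ctranspose T ** M'"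
      using arg_cong[OF TM, of ctranspose] M by (simp add: ctranspose_mult)
    have "(ctranspose T ** T) ** M = ctranspose T ** M' ** T"
      by (simp add: matrix_mul_assoc[symmetric] TM)
    also have "\<dots> = M ** (ctranspose T ** T)" by (simp add: TM'[symmetric] matrix_mul_assoc)
    finally have "H ** M = M ** H" by (rule comm)
    then have "?K ** (H ** M) ** ?K = ?K ** (M ** H) ** ?K" by simp
    then have "(?K ** H) ** M ** ?K = ?K ** M ** (H ** ?K)" by (simp only: matrix_mul_assoc)
    then have "M ** ?K = ?K ** M" by (simp add: K)
    then show ?thesis by (metis TM matrix_mul_assoc)
  qed
  ultimately show ?thesis using that by blast
qed

text \<open>
  Congruence is quadratic in \<open>G\<close>, but the condition on the right is linear in \<open>(P, Q)\<close> apart from the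
  invertibility of \<open>P\<close>. A congruence gives \<open>P = G\<^sup>*\<close> and \<open>Q = G\<^sup>-\<^sup>1\<close>. Conversely, after normalising \<open>X\<close>
  and \<open>X'\<close> to the identity by factors \<open>S\<close> and \<open>S'\<close>, the pair \<open>(P, Q)\<close> becomes a single similarity \<open>T\<close> of
  Hermitian matrices, which can be replaced by a unitary one.
\<close>
lemma pd_rel_iff_equivalent:
  fixes X Y Z X' Y' Z' :: "'n::finite cmat"
  shows "((X, Y, Z), (X', Y', Z')) \<in> pd_rel \<longleftrightarrow>
    (X, Y, Z) \<in> pd_triples \<and> (X', Y', Z') \<in> pd_triples \<and>
    (\<exists>P Q. P ** X = X' ** Q \<and> P ** Y = Y' ** Q \<and> P ** Z = Z' ** Q \<and> det P \<noteq> 0)"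
proof
  assume "((X, Y, Z), (X', Y', Z')) \<in> pd_rel"
  then obtain G where G: "invertible G" "X' = ctranspose G ** X ** G"
    "Y' = ctranspose G ** Y ** G" "Z' = ctranspose G ** Z ** G" and pd: "(X, Y, Z) \<in> pd_triples"
    unfolding pd_rel_def by blast
  have "ctranspose G ** M = ctranspose G ** M ** G ** matrix_inv G" for M
    using matrix_inv_cancel(1)[OF G(1)] by (simp add: matrix_mul_assoc[symmetric])
  moreover have "invertible (ctranspose G)"
    unfolding invertible_def
    using arg_cong[OF matrix_inv_cancel(1)[OF G(1)], of ctranspose]
      arg_cong[OF matrix_inv_cancel(2)[OF G(1)], of ctranspose]
    by (intro exI[of _ "ctranspose (matrix_inv G)"]) (simp add: ctranspose_mult)
  ultimately show "(X, Y, Z) \<in> pd_triples \<and> (X', Y', Z') \<in> pd_triples \<and>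
    (\<exists>P Q. P ** X = X' ** Q \<and> P ** Y = Y' ** Q \<and> P ** Z = Z' ** Q \<and> det P \<noteq> 0)"
    using pd G by (auto simp: pd_triples_def positive_definite_congruence invertible_det_nz)
next
  assume R: "(X, Y, Z) \<in> pd_triples \<and> (X', Y', Z') \<in> pd_triples \<and>
    (\<exists>P Q. P ** X = X' ** Q \<and> P ** Y = Y' ** Q \<and> P ** Z = Z' ** Q \<and> det P \<noteq> 0)"
  then obtain P Q where PQ: "P ** X = X' ** Q" "P ** Y = Y' ** Q" "P ** Z = Z' ** Q" "invertible P"
    by (auto simp: invertible_det_nz)
  have "positive_definite X" "positive_definite X'" using R by (auto simp: pd_triples_def)
  then obtain S S' where S: "invertible S" "X = ctranspose S ** S"
    and S': "invertible S'" "X' = ctranspose S' ** S'"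
    using positive_definite_factor by metis
  let ?R = "matrix_inv S" and ?R' = "matrix_inv S'"
  note inv = matrix_inv_cancel[OF S(1)] matrix_inv_cancel[OF S'(1)]
  have cinv: "ctranspose ?R ** ctranspose S = mat 1" "ctranspose S ** ctranspose ?R = mat 1"
    "ctranspose ?R' ** ctranspose S' = mat 1" "ctranspose S' ** ctranspose ?R' = mat 1"
    using inv[THEN arg_cong[of _ _ ctranspose]] by (simp_all add: ctranspose_mult)
  (* The equation P X = X' Q says that P and Q induce the same map T in the normalised coordinates. *)
  define T where "T = S' ** Q ** ?R"
  have can: "S ** (?R ** M) = M" "?R ** (S ** M) = M" "S' ** (?R' ** M) = M" "?R' ** (S' ** M) = M"
    "ctranspose ?R ** (ctranspose S ** M) = M" "ctranspose S ** (ctranspose ?R ** M) = M"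
    "ctranspose ?R' ** (ctranspose S' ** M) = M" "ctranspose S' ** (ctranspose ?R' ** M) = M" for M
    using inv cinv by (simp_all add: matrix_mul_assoc)
  have T: "T = ctranspose ?R' ** P ** ctranspose S"
  proof -
    have "ctranspose ?R' ** (P ** X) ** ?R = ctranspose ?R' ** (X' ** Q) ** ?R" using PQ(1) by simp
    then show ?thesis
      by (simp add: T_def S(2) S'(2) matrix_mul_assoc[symmetric] can inv)
  qed
  have "invertible T"
  proof -
    have "invertible (ctranspose ?R')" "invertible (ctranspose S)"
      using cinv unfolding invertible_def by blast+
    then show ?thesis unfolding T using PQ(4) by (intro invertible_mult)
  qed
  then obtain U where U: "unitary U" and U': "\<And>M M'. ctranspose M = M \<Longrightarrow> ctranspose M' = M' \<Longrightarrow>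
    T ** M = M' ** T \<Longrightarrow> U ** M = M' ** U" using unitary_of_similar_hermitian by metis
  define G where "G = ?R ** ctranspose U ** S'"
  have "invertible G"
    unfolding G_def using U S'(1) inv
    by (intro invertible_mult unitary_invertible[OF unitary_ctranspose]) (auto simp: invertible_def)
  moreover have cong: "N' = ctranspose G ** N ** G"
    if N: "ctranspose N = N" "ctranspose N' = N'" and PN: "P ** N = N' ** Q" for N N'
  proof -
    let ?M = "ctranspose ?R ** N ** ?R" and ?M' = "ctranspose ?R' ** N' ** ?R'"
    have "T ** ?M = ctranspose ?R' ** (P ** N) ** ?R"
      by (simp add: T matrix_mul_assoc[symmetric] can)
    also have "\<dots> = ?M' ** T"
      unfolding PN by (simp add: T_def matrix_mul_assoc[symmetric] can)
    finally have "U ** ?M = ?M' ** U"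
      using N by (intro U') (simp_all add: ctranspose_mult matrix_mul_assoc)
    then have "U ** ?M ** ctranspose U = ?M'"
      using U by (simp add: matrix_mul_assoc[symmetric] unitary_def)
    then have "ctranspose S' ** (U ** ?M ** ctranspose U) ** S' = ctranspose S' ** ?M' ** S'" by simp
    also have "\<dots> = N'" by (simp add: matrix_mul_assoc[symmetric] can inv)
    finally show ?thesis by (simp add: G_def ctranspose_mult matrix_mul_assoc)
  qed
  ultimately show "((X, Y, Z), (X', Y', Z')) \<in> pd_rel"
    using R PQ by (auto simp: pd_rel_def pd_triples_def positive_definite_def intro!: exI[of _ G])
qed

lemma semialgebraic_pd_rel:
  "semialgebraic (pd_rel :: (('n::finite cmat \<times> 'n cmat \<times> 'n cmat) \<times> ('n cmat \<times> 'n cmat \<times> 'n cmat)) set)"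
proof -
  let ?L = "\<lambda>(p :: ('n cmat \<times> 'n cmat \<times> 'n cmat) \<times> ('n cmat \<times> 'n cmat \<times> 'n cmat)) (q :: 'n cmat \<times> 'n cmat).
    (fst q ** fst (fst p) - fst (snd p) ** snd q,
     fst q ** fst (snd (fst p)) - fst (snd (snd p)) ** snd q,
     fst q ** snd (snd (fst p)) - snd (snd (snd p)) ** snd q)"
  have lin: "linear (?L p)" for p
    by (rule linearI)
      (simp_all add: vec_eq_iff matrix_matrix_mult_def sum.distrib algebra_simps scaleR_sum_right)
  have "semialgebraic {p. \<exists>q. ?L p q = 0 \<and> (\<lambda>(p, q). det (fst q) \<bullet> det (fst q)) (p, q) \<noteq> 0}"
    unfolding case_prod_unfold
    by (intro semialgebraic_ex_linear polynomial_function_matrix_intros polynomial_function_intros)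
      (use lin in \<open>simp add: case_prod_unfold\<close>)
  then have "semialgebraic {p. fst p \<in> pd_triples \<and> snd p \<in> pd_triples \<and>
      (\<exists>q. ?L p q = 0 \<and> (\<lambda>(p, q). det (fst q) \<bullet> det (fst q)) (p, q) \<noteq> 0)}"
    by (intro semialgebraic_conj semialgebraic_vimage semialgebraic_pd_triples
        polynomial_function_intros)
  moreover have "pd_rel = {p :: ('n cmat \<times> 'n cmat \<times> 'n cmat) \<times> ('n cmat \<times> 'n cmat \<times> 'n cmat).
      fst p \<in> pd_triples \<and> snd p \<in> pd_triples \<and>
      (\<exists>q. ?L p q = 0 \<and> (\<lambda>(p, q). det (fst q) \<bullet> det (fst q)) (p, q) \<noteq> 0)}"
    by (auto simp: pd_rel_iff_equivalent zero_prod_def; blast)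
  ultimately show ?thesis by simp
qed

section \<open>Reduction of multiplicative triples to Gram matrices\<close>

definition gram_triple :: "'n::finite cmat \<times> 'n cmat \<times> 'n cmat \<Rightarrow> 'n cmat \<times> 'n cmat \<times> 'n cmat" where
  "gram_triple = (\<lambda>(A, B, C). (ctranspose A ** A, mat 1, ctranspose (C ** A) ** (C ** A)))"

lemma gram_triple_pd: "p \<in> mult_triples \<Longrightarrow> gram_triple p \<in> pd_triples"
  using positive_definite_gram[of "mat 1"]
  by (auto simp: gram_triple_def mult_triples_def pd_triples_def invertible_mult
      positive_definite_gram unitary_invertible unitary_one)

lemma isometric_imp_unitary_factor:
  fixes M N :: "'n::finite cmat"
  assumes "invertible M" "invertible N" "ctranspose M ** M = ctranspose N ** N"
  shows "unitary (N ** matrix_inv M)"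
proof (rule unitaryI)
  note inv = matrix_inv_cancel[OF assms(1)]
  have "ctranspose (N ** matrix_inv M) ** (N ** matrix_inv M)
      = ctranspose (matrix_inv M) ** (ctranspose N ** N) ** matrix_inv M"
    by (simp add: ctranspose_mult matrix_mul_assoc)
  also have "\<dots> = ctranspose (M ** matrix_inv M) ** (M ** matrix_inv M)"
    by (simp only: assms(3)[symmetric] ctranspose_mult matrix_mul_assoc)
  finally show "ctranspose (N ** matrix_inv M) ** (N ** matrix_inv M) = mat 1" by (simp add: inv)
qed

text \<open>
  Only \<open>U\<close>, the change of basis of the space that carries the identity form, survives in the Gram
  triple; \<open>V\<close> and \<open>W\<close> cancel.
\<close>
lemma gram_triple_cong:
  assumes "(p, q) \<in> mult_rel"
  shows "(gram_triple p, gram_triple q) \<in> pd_rel"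
proof -
  obtain A B C where p: "p = (A, B, C)" by (cases p)
  obtain U V W where UVW: "unitary U" "unitary V" "unitary W"
    and q: "q = (ctranspose W ** A ** U, ctranspose U ** B ** V, ctranspose V ** C ** W)"
    and T: "(A, B, C) \<in> mult_triples"
    using assms p by (cases q) (auto simp: mult_rel_def unitary_inv)
  have "gram_triple q = (ctranspose U ** (ctranspose A ** A) ** U, ctranspose U ** mat 1 ** U,
    ctranspose U ** (ctranspose (C ** A) ** (C ** A)) ** U)"
    using UVW by (simp add: q gram_triple_def ctranspose_mult matrix_mul_assoc[symmetric]
        unitary_cancel) (simp add: unitary_def)
  then show ?thesis
    using gram_triple_pd[OF T] unitary_invertible[OF UVW(1)]
    by (auto simp: pd_rel_def p gram_triple_def)
qed

text \<open>
  A congruence between Gram triples is given by some \<open>U\<close> that preserves the identity form, so \<open>U\<close> is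
  unitary. Then \<open>A U\<close> and \<open>A'\<close> have the same Gram matrix and differ by a unitary \<open>W\<close>, and likewise
  \<open>C A U\<close> and \<open>C' A'\<close> by a unitary \<open>V\<close>. The relation for \<open>B\<close> follows since \<open>B\<close> is inverse to \<open>C A\<close>.
  This makes \<open>mult_rel\<close> a polynomial preimage of \<open>pd_rel\<close>.
\<close>
lemma mult_rel_iff_gram:
  fixes p q :: "'n::finite cmat \<times> 'n cmat \<times> 'n cmat"
  shows "(p, q) \<in> mult_rel \<longleftrightarrow>
    p \<in> mult_triples \<and> q \<in> mult_triples \<and> (gram_triple p, gram_triple q) \<in> pd_rel"
proof
  assume "(p, q) \<in> mult_rel"
  then show "p \<in> mult_triples \<and> q \<in> mult_triples \<and> (gram_triple p, gram_triple q) \<in> pd_rel"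
    using gram_triple_cong equiv_mult_rel unfolding equiv_def by blast
next
  assume R: "p \<in> mult_triples \<and> q \<in> mult_triples \<and> (gram_triple p, gram_triple q) \<in> pd_rel"
  obtain A B C where p: "p = (A, B, C)" by (cases p)
  obtain A' B' C' where q: "q = (A', B', C')" by (cases q)
  have pT: "invertible A" "invertible B" "invertible C" "A ** B ** C = mat 1"
    and qT: "invertible A'" "invertible B'" "invertible C'" "A' ** B' ** C' = mat 1"
    using R by (auto simp: p q mult_triples_def)
  obtain U where "invertible U" and 1: "ctranspose A' ** A' = ctranspose U ** (ctranspose A ** A) ** U"
    and 2: "mat 1 = ctranspose U ** U"
    and 3: "ctranspose (C' ** A') ** (C' ** A') = ctranspose U ** (ctranspose (C ** A) ** (C ** A)) ** U"
    using R by (auto simp: p q pd_rel_def gram_triple_def)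
  have U: "unitary U" using 2 by (intro unitaryI) simp
  define W where "W = (A ** U) ** matrix_inv A'"
  define V where "V = (C ** A ** U) ** matrix_inv (C' ** A')"
  have iU: "invertible (A ** U)" "invertible (C ** A ** U)" "invertible (C' ** A')"
    using pT qT unitary_invertible[OF U] by (auto intro: invertible_mult)
  have W: "unitary W" unfolding W_def
    using 1 by (intro isometric_imp_unitary_factor qT iU) (simp add: ctranspose_mult matrix_mul_assoc)
  have V: "unitary V" unfolding V_def
    using 3 by (intro isometric_imp_unitary_factor iU) (simp add: ctranspose_mult matrix_mul_assoc)
  have WA: "W ** A' = A ** U" unfolding W_def
    by (simp add: matrix_mul_assoc[symmetric] matrix_inv_cancel[OF qT(1)])
  have VCA: "V ** (C' ** A') = C ** A ** U" unfolding V_def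
    by (simp add: matrix_mul_assoc[symmetric] matrix_inv_cancel[OF iU(3)])
  have A': "A' = ctranspose W ** A ** U"
    using arg_cong[OF WA, of "\<lambda>M. ctranspose W ** M"] W by (simp add: matrix_mul_assoc unitary_def)
  have "V ** C' ** A' = C ** W ** A'" using VCA WA by (simp add: matrix_mul_assoc[symmetric])
  then have "V ** C' = C ** W"
    using matrix_inv_cancel(1)[OF qT(1)] by (metis matrix_mul_assoc matrix_mul_rid)
  then have C': "C' = ctranspose V ** C ** W"
    by (metis V matrix_mul_assoc unitary_cancel(1))
  have B: "B ** (C ** A) = mat 1" "(C ** A) ** B = mat 1" if "A ** B ** C = mat 1" for A B C :: "'n cmat"
  proof -
    have "(B ** C) ** A = mat 1" using that by (metis matrix_left_right_inverse matrix_mul_assoc)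
    then show "B ** (C ** A) = mat 1" by (simp add: matrix_mul_assoc)
    then show "(C ** A) ** B = mat 1" by (metis matrix_left_right_inverse)
  qed
  have "ctranspose U ** B ** V ** (C' ** A') = mat 1"
    using B(1)[OF pT(4)] 2[symmetric] by (simp add: matrix_mul_assoc[symmetric] VCA)
      (simp add: matrix_mul_assoc)
  then have "B' = ctranspose U ** B ** V"
    using B(2)[OF qT(4)] by (metis matrix_mul_assoc matrix_mul_lid matrix_mul_rid)
  with U V W A' C' have "\<exists>U V W. unitary U \<and> unitary V \<and> unitary W \<and>
      A' = matrix_inv W ** A ** U \<and> B' = matrix_inv U ** B ** V \<and> C' = matrix_inv V ** C ** W"
    by (metis unitary_inv)
  then show "(p, q) \<in> mult_rel" using R by (simp add: p q mult_rel_def)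
qed

lemma polynomial_function_gram_triple: "polynomial_function (\<lambda>p. gram_triple (f p))"
  if "polynomial_function f" for f :: "'a::euclidean_space \<Rightarrow> 'n::finite cmat \<times> 'n cmat \<times> 'n cmat"
  unfolding gram_triple_def case_prod_unfold
  using that by (intro polynomial_function_matrix_intros polynomial_function_intros)

lemma semialgebraic_mult_rel:
  "semialgebraic (mult_rel :: (('n::finite cmat \<times> 'n cmat \<times> 'n cmat) \<times> ('n cmat \<times> 'n cmat \<times> 'n cmat)) set)"
proof -
  have "mult_rel = {r :: ('n cmat \<times> 'n cmat \<times> 'n cmat) \<times> ('n cmat \<times> 'n cmat \<times> 'n cmat).
     fst r \<in> mult_triples \<and> snd r \<in> mult_triples \<and> (gram_triple (fst r), gram_triple (snd r)) \<in> pd_rel}"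
    by (auto simp: mult_rel_iff_gram)
  also have "semialgebraic \<dots>"
    by (intro semialgebraic_conj semialgebraic_vimage semialgebraic_mult_triples semialgebraic_pd_rel
        polynomial_function_gram_triple polynomial_function_intros)
  finally show ?thesis .
qed

section \<open>The homeomorphism of quotients\<close>

text \<open>
  Cramer's rule writes the entries of the inverse as quotients of polynomials.
\<close>
lemma continuous_on_matrix_inv: "continuous_on {S :: 'n::finite cmat. invertible S} matrix_inv"
proof -
  let ?D = "\<lambda>i j S :: 'n cmat. det (\<chi> a b. if b = i then axis j 1 $ a else S $ a $ b)"
  have cramer: "matrix_inv S = (\<chi> i j. ?D i j S / det S)" if "invertible S" for S :: "'n cmat"
  proof -
    have "matrix_inv S *v axis j 1 = (\<chi> i. ?D i j S / det S)" for j
    proof (subst cramer[symmetric])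
      show "det S \<noteq> 0" using that by (simp add: invertible_det_nz)
      show "S *v (matrix_inv S *v axis j 1) = axis j 1"
        using matrix_inv_cancel(1)[OF that] by (simp add: matrix_vector_mul_assoc)
    qed
    moreover have "matrix_inv S $ i $ j = (matrix_inv S *v axis j 1) $ i" for i j
      by (simp add: matrix_vector_mult_def axis_def if_distrib cong: if_cong)
    ultimately show ?thesis by (simp add: vec_eq_iff)
  qed
  have "continuous_on A (?D i j)" for i j A
  proof (intro continuous_on_polymonial_function polynomial_function_det polynomial_function_vec)
    fix a b
    show "polynomial_function (\<lambda>S :: 'n cmat. if b = i then axis j 1 $ a else S $ a $ b)"
      by (cases "b = i") (auto intro: polynomial_function_nth)
  qed
  moreover have "continuous_on A det" for A :: "'n cmat set"
    by (intro continuous_on_polymonial_function polynomial_function_det polynomial_function_id)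
  ultimately have "continuous_on {S. invertible S} (\<lambda>S. \<chi> i j. ?D i j S / det S)"
    by (intro continuous_intros) (auto simp: invertible_det_nz)
  then show ?thesis by (rule continuous_on_eq) (simp add: cramer)
qed

definition invertible_triples :: "('n::finite cmat \<times> 'n cmat \<times> 'n cmat) set" where
  "invertible_triples = {(R, S, T). invertible R \<and> invertible S \<and> invertible T}"

definition gram3 :: "'n::finite cmat \<times> 'n cmat \<times> 'n cmat \<Rightarrow> 'n cmat \<times> 'n cmat \<times> 'n cmat" where
  "gram3 = (\<lambda>(R, S, T). (ctranspose R ** R, ctranspose S ** S, ctranspose T ** T))"

text \<open>
  The inverse construction: \<open>(R, S, T)\<close> stands for the forms \<open>(R\<^sup>*R, S\<^sup>*S, T\<^sup>*T)\<close> with chosen orthonormal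
  bases, and the three matrices are the changes of basis between them.
\<close>
definition quotient_triple :: "'n::finite cmat \<times> 'n cmat \<times> 'n cmat \<Rightarrow> 'n cmat \<times> 'n cmat \<times> 'n cmat" where
  "quotient_triple = (\<lambda>(R, S, T). (R ** matrix_inv S, S ** matrix_inv T, T ** matrix_inv R))"

text \<open>
  The squared norm of \<open>S\<close> is the trace of \<open>S\<^sup>*S\<close>.
\<close>
lemma norm_matrix_le_gram:
  fixes S :: "'n::finite cmat"
  shows "(norm S)\<^sup>2 \<le> CARD('n) * norm (ctranspose S ** S)"
proof -
  have "(norm S)\<^sup>2 = (\<Sum>i\<in>UNIV. \<Sum>j\<in>UNIV. (cmod (S $ i $ j))\<^sup>2)"
    by (simp add: norm_vec_def L2_set_def sum_nonneg)
  also have "\<dots> = (\<Sum>j\<in>UNIV. \<Sum>i\<in>UNIV. (cmod (S $ i $ j))\<^sup>2)" by (rule sum.swap)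
  also have "\<dots> \<le> (\<Sum>j\<in>(UNIV :: 'n set). norm (ctranspose S ** S))"
  proof (rule sum_mono)
    fix j
    have entry: "complex_of_real (\<Sum>i\<in>UNIV. (cmod (S $ i $ j))\<^sup>2) = (ctranspose S ** S) $ j $ j"
      by (simp add: matrix_matrix_mult_def ctranspose_def complex_norm_square mult.commute
          del: of_real_power)
    have "(\<Sum>i\<in>UNIV. (cmod (S $ i $ j))\<^sup>2) = cmod ((ctranspose S ** S) $ j $ j)"
      unfolding entry[symmetric] norm_of_real by (simp add: sum_nonneg)
    also have "\<dots> \<le> norm (ctranspose S ** S)"
      by (rule order_trans[OF Finite_Cartesian_Product.norm_nth_le Finite_Cartesian_Product.norm_nth_le])
    finally show "(\<Sum>i\<in>UNIV. (cmod (S $ i $ j))\<^sup>2) \<le> norm (ctranspose S ** S)" .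
  qed
  finally show ?thesis by simp
qed

lemma invertible_of_gram:
  assumes "positive_definite (ctranspose S ** S)"
  shows "invertible S"
proof -
  obtain H where H: "H ** H = ctranspose S ** S" "invertible H"
    using positive_definite_sqrt[OF assms] by metis
  have "det H * det H = det (ctranspose S) * det S"
    using arg_cong[OF H(1), of det] by (simp add: det_mul)
  then show ?thesis using H(2) by (auto simp: invertible_det_nz)
qed

lemma continuous_gram3: "continuous_on A (gram3 :: 'n::finite cmat \<times> 'n cmat \<times> 'n cmat \<Rightarrow> _)"
  unfolding gram3_def case_prod_unfold
  by (intro continuous_on_polymonial_function polynomial_function_matrix_intros
      polynomial_function_intros)

text \<open>
  Properness. The preimage is taken among all triples of matrices, where it is closed; it consists of
  invertible triples as soon as \<open>K\<close> consists of positive definite ones.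
\<close>
lemma compact_vimage_gram3:
  fixes K :: "('n::finite cmat \<times> 'n cmat \<times> 'n cmat) set"
  assumes "compact K"
  shows "compact (gram3 -` K)"
proof -
  obtain b where b: "\<And>x. x \<in> K \<Longrightarrow> norm x \<le> b"
    using compact_imp_bounded[OF assms] bounded_iff by metis
  let ?c = "sqrt (CARD('n) * b)"
  have "norm p \<le> ?c + (?c + ?c)" if "gram3 p \<in> K" for p :: "'n cmat \<times> 'n cmat \<times> 'n cmat"
  proof -
    obtain R S T where p: "p = (R, S, T)" by (cases p)
    have *: "norm M \<le> ?c" if "norm (ctranspose M ** M) \<le> b" for M :: "'n cmat"
    proof (rule real_le_rsqrt)
      have "CARD('n) * norm (ctranspose M ** M) \<le> CARD('n) * b"
        using that by (intro mult_left_mono) auto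
      then show "(norm M)\<^sup>2 \<le> CARD('n) * b" using norm_matrix_le_gram[of M] by linarith
    qed
    have "norm (gram3 p) \<le> b" using b that .
    then have "norm (ctranspose R ** R) \<le> b" "norm (ctranspose S ** S) \<le> b"
      "norm (ctranspose T ** T) \<le> b"
      unfolding p gram3_def prod.case by (meson norm_fst_le norm_snd_le order_trans)+
    then have "norm R \<le> ?c" "norm S \<le> ?c" "norm T \<le> ?c" using * by auto
    then show ?thesis unfolding p
      using norm_Pair_le[of R "(S, T)"] norm_Pair_le[of S T] by linarith
  qed
  then have "bounded (gram3 -` K)" unfolding bounded_iff by blast
  moreover have "closed (gram3 -` K)"
    by (rule closed_vimage[OF compact_imp_closed[OF assms] continuous_gram3])
  ultimately show ?thesis by (simp add: compact_eq_bounded_closed)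
qed

lemma quotient_map_gram3:
  "quotient_map (top_of_set invertible_triples)
    (top_of_set (pd_triples :: ('n::finite cmat \<times> 'n cmat \<times> 'n cmat) set)) gram3"
proof (rule continuous_closed_imp_quotient_map)
  let ?I = "invertible_triples :: ('n cmat \<times> 'n cmat \<times> 'n cmat) set"
  have image: "gram3 ` ?I = pd_triples"
  proof
    show "gram3 ` ?I \<subseteq> pd_triples"
      by (auto simp: gram3_def invertible_triples_def pd_triples_def positive_definite_gram)
    show "pd_triples \<subseteq> gram3 ` ?I"
    proof
      fix p :: "'n cmat \<times> 'n cmat \<times> 'n cmat" assume "p \<in> pd_triples"
      then obtain X Y Z where p: "p = (X, Y, Z)" "positive_definite X" "positive_definite Y"
        "positive_definite Z" by (auto simp: pd_triples_def)
      obtain R S T where "invertible R" "X = ctranspose R ** R" "invertible S" "Y = ctranspose S ** S"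
        "invertible T" "Z = ctranspose T ** T" using p positive_definite_factor by metis
      then show "p \<in> gram3 ` ?I"
        by (intro image_eqI[of _ _ "(R, S, T)"]) (auto simp: p(1) gram3_def invertible_triples_def)
    qed
  qed
  show "continuous_map (top_of_set ?I) (top_of_set pd_triples) gram3"
    using image continuous_gram3 by (simp add: continuous_map_in_subtopology) blast
  show "gram3 ` topspace (top_of_set ?I) = topspace (top_of_set pd_triples)" using image by simp
  have "closedin (top_of_set pd_triples) (gram3 ` K)" if "closedin (top_of_set ?I) K" for K
  proof (rule proper_map[OF that])
    fix U :: "('n cmat \<times> 'n cmat \<times> 'n cmat) set" assume "U \<subseteq> pd_triples" "compact U"
    moreover have "gram3 -` U \<subseteq> ?I" if "U \<subseteq> pd_triples"
      using that
      by (auto simp: gram3_def invertible_triples_def pd_triples_def intro!: invertible_of_gram)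
    ultimately show "compact (?I \<inter> gram3 -` U)"
      by (simp add: compact_vimage_gram3 Int_absorb1)
  qed (simp add: image)
  then show "closed_map (top_of_set ?I) (top_of_set pd_triples) gram3" by (simp add: closed_map_def)
qed

lemma quotient_triple_mult:
  "p \<in> invertible_triples \<Longrightarrow> quotient_triple p \<in> mult_triples"
proof -
  assume "p \<in> invertible_triples"
  then obtain R S T where p: "p = (R, S, T)" and inv: "invertible R" "invertible S" "invertible T"
    by (auto simp: invertible_triples_def)
  have iinv: "invertible (matrix_inv M)" if "invertible M" for M :: "'a cmat"
    using matrix_inv_cancel[OF that] invertible_def by blast
  have "R ** matrix_inv S ** (S ** matrix_inv T) ** (T ** matrix_inv R)
      = R ** (matrix_inv S ** S) ** (matrix_inv T ** T) ** matrix_inv R"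
    by (simp only: matrix_mul_assoc)
  also have "\<dots> = mat 1" using inv by (simp add: matrix_inv_cancel)
  finally show ?thesis
    using inv by (simp add: p quotient_triple_def mult_triples_def invertible_mult iinv)
qed

lemma continuous_quotient_triple: "continuous_on invertible_triples quotient_triple"
proof -
  have mult: "continuous_on A (\<lambda>x. f x ** g x)" if "continuous_on A f" "continuous_on A g"
    for A and f g :: "'n::finite cmat \<times> 'n cmat \<times> 'n cmat \<Rightarrow> 'n cmat"
    using that unfolding matrix_matrix_mult_def by (intro continuous_intros)
  have inv: "continuous_on A (\<lambda>x. matrix_inv (f x))" if "continuous_on A f" "\<And>x. x \<in> A \<Longrightarrow> invertible (f x)"
    for A and f :: "'n::finite cmat \<times> 'n cmat \<times> 'n cmat \<Rightarrow> 'n cmat"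
    using that by (intro continuous_on_compose2[OF continuous_on_matrix_inv]) auto
  show ?thesis
    unfolding quotient_triple_def case_prod_unfold
    by (intro continuous_on_Pair mult inv continuous_intros) (auto simp: invertible_triples_def)
qed

text \<open>
  The congruence is by the inverse of \<open>S\<close>, which turns the middle form \<open>S\<^sup>*S\<close> into the identity.
\<close>
lemma gram_quotient_triple:
  assumes "p \<in> invertible_triples"
  shows "(gram3 p, gram_triple (quotient_triple p)) \<in> pd_rel"
proof -
  obtain R S T where p: "p = (R, S, T)" and inv: "invertible R" "invertible S" "invertible T"
    using assms by (auto simp: invertible_triples_def)
  let ?G = "matrix_inv S"
  have "ctranspose ?G ** (ctranspose S ** S) ** ?G = ctranspose (S ** ?G) ** (S ** ?G)"
    by (simp only: ctranspose_mult matrix_mul_assoc)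
  then have 1: "ctranspose ?G ** (ctranspose S ** S) ** ?G = mat 1"
    by (simp add: matrix_inv_cancel[OF inv(2)])
  have "T ** matrix_inv R ** (R ** ?G) = T ** (matrix_inv R ** R) ** ?G"
    by (simp only: matrix_mul_assoc)
  then have 2: "T ** matrix_inv R ** (R ** ?G) = T ** ?G" by (simp add: matrix_inv_cancel[OF inv(1)])
  have "gram_triple (quotient_triple p) = (ctranspose ?G ** (ctranspose R ** R) ** ?G,
      ctranspose ?G ** (ctranspose S ** S) ** ?G, ctranspose ?G ** (ctranspose T ** T) ** ?G)"
    by (simp only: p gram_triple_def quotient_triple_def prod.case 1 2)
      (simp only: ctranspose_mult matrix_mul_assoc)
  moreover have "invertible ?G" using matrix_inv_cancel[OF inv(2)] invertible_def by blast
  moreover have "gram3 p \<in> pd_triples"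
    using inv by (simp add: p gram3_def pd_triples_def positive_definite_gram)
  ultimately show ?thesis by (auto simp: pd_rel_def p gram3_def)
qed

definition beta :: "('n::finite cmat \<times> 'n cmat \<times> 'n cmat) set \<Rightarrow> ('n cmat \<times> 'n cmat \<times> 'n cmat) set" where
  "beta T = pd_rel `` (gram_triple ` T)"

lemma beta_class:
  assumes "p \<in> mult_triples"
  shows "beta (mult_rel `` {p}) = pd_rel `` {gram_triple p}"
proof
  have "pd_rel `` {gram_triple q} = pd_rel `` {gram_triple p}" if "(p, q) \<in> mult_rel" for q
    using equiv_class_eq[OF equiv_pd_rel gram_triple_cong[OF that]] by simp
  then show "beta (mult_rel `` {p}) \<subseteq> pd_rel `` {gram_triple p}"
    unfolding beta_def by blast
  show "pd_rel `` {gram_triple p} \<subseteq> beta (mult_rel `` {p})"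
    using equiv_class_self[OF equiv_mult_rel assms] unfolding beta_def by blast
qed

text \<open>
  Continuity of \<open>beta\<close> is inherited from the polynomial map upstairs. For the inverse, the composite of
  \<open>quotient_triple\<close> with the projection and \<open>beta\<close> equals \<open>gram3\<close> followed by the projection, which is a
  quotient map; so \<open>beta\<close> itself is a quotient map, and an injective quotient map is a homeomorphism.
\<close>
lemma homeomorphic_map_beta:
  "homeomorphic_map (quotient_topology (top_of_set mult_triples) mult_rel)
    (quotient_topology (top_of_set (pd_triples :: ('n::finite cmat \<times> 'n cmat \<times> 'n cmat) set)) pd_rel) beta"
    (is "homeomorphic_map ?X ?Y _")
  unfolding homeomorphic_map_def
proof
  let ?M = "mult_triples :: ('n cmat \<times> 'n cmat \<times> 'n cmat) set"
    and ?I = "invertible_triples :: ('n cmat \<times> 'n cmat \<times> 'n cmat) set"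
  let ?pi = "\<lambda>p. mult_rel `` {p}" and ?pi' = "\<lambda>p. pd_rel `` {p}"
  have pi: "quotient_map (top_of_set ?M) ?X ?pi" and pi': "quotient_map (top_of_set pd_triples) ?Y ?pi'"
    by (rule quotient_map_quotient_topology)+
  have "continuous_map (top_of_set ?M) (top_of_set pd_triples) gram_triple"
    using continuous_on_polymonial_function[OF polynomial_function_gram_triple[OF polynomial_function_id]]
    by (auto simp: continuous_map_in_subtopology gram_triple_pd)
  then have "continuous_map (top_of_set ?M) ?Y (?pi' \<circ> gram_triple)"
    using quotient_imp_continuous_map[OF pi'] by (rule continuous_map_compose)
  then have "continuous_map (top_of_set ?M) ?Y (beta \<circ> ?pi)"
    by (rule continuous_map_eq) (simp add: beta_class)
  with pi have cont: "continuous_map ?X ?Y beta" by (rule continuous_compose_quotient_map)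
  have "continuous_map (top_of_set ?I) (top_of_set ?M) quotient_triple"
    using continuous_quotient_triple by (auto simp: continuous_map_in_subtopology quotient_triple_mult)
  then have lift: "continuous_map (top_of_set ?I) ?X (?pi \<circ> quotient_triple)"
    using quotient_imp_continuous_map[OF pi] by (rule continuous_map_compose)
  have "quotient_map (top_of_set ?I) ?Y (?pi' \<circ> gram3)"
    using quotient_map_gram3 pi' by (rule quotient_map_compose)
  then have "quotient_map (top_of_set ?I) ?Y (beta \<circ> (?pi \<circ> quotient_triple))"
  proof (rule quotient_map_eq)
    fix p assume "p \<in> topspace (top_of_set ?I)"
    then have p: "p \<in> ?I" by simp
    show "(?pi' \<circ> gram3) p = (beta \<circ> (?pi \<circ> quotient_triple)) p"
      using equiv_class_eq[OF equiv_pd_rel gram_quotient_triple[OF p]]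
      by (simp add: beta_class quotient_triple_mult p)
  qed
  with lift cont show "quotient_map ?X ?Y beta" by (rule quotient_map_from_composition)
  show "inj_on beta (topspace ?X)"
  proof (rule inj_onI)
    fix s t assume "s \<in> topspace ?X" "t \<in> topspace ?X" and eq: "beta s = beta t"
    then obtain p q where p: "p \<in> ?M" "s = ?pi p" and q: "q \<in> ?M" "t = ?pi q"
      by (auto simp: topspace_quotient_topology elim!: quotientE)
    have "?pi' (gram_triple p) = ?pi' (gram_triple q)"
      using eq by (simp add: p q beta_class)
    then have "(gram_triple p, gram_triple q) \<in> pd_rel"
      using eq_equiv_class[OF _ equiv_pd_rel] gram_triple_pd[OF q(1)] by blast
    then have "(p, q) \<in> mult_rel" using p q by (simp add: mult_rel_iff_gram)
    then show "s = t" using equiv_class_eq[OF equiv_mult_rel] by (simp add: p q)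
  qed
qed

lemma semialgebraic_graph_beta:
  "semialgebraic {(x, y). x \<in> mult_triples \<and> y \<in> (pd_triples :: ('n::finite cmat \<times> 'n cmat \<times> 'n cmat) set) \<and>
     beta (mult_rel `` {x}) = pd_rel `` {y}}"
proof -
  have "beta (mult_rel `` {x}) = pd_rel `` {y} \<longleftrightarrow> (gram_triple x, y) \<in> pd_rel"
    if "x \<in> mult_triples" "y \<in> pd_triples" for x y :: "'n cmat \<times> 'n cmat \<times> 'n cmat"
    unfolding beta_class[OF that(1)]
    by (rule eq_equiv_class_iff[OF equiv_pd_rel gram_triple_pd[OF that(1)] that(2)])
  then have "{(x, y). x \<in> mult_triples \<and> y \<in> (pd_triples :: ('n cmat \<times> 'n cmat \<times> 'n cmat) set) \<and>
      beta (mult_rel `` {x}) = pd_rel `` {y}}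
    = {r. fst r \<in> mult_triples \<and> snd r \<in> pd_triples \<and> (gram_triple (fst r), snd r) \<in> pd_rel}"
    by (intro set_eqI) (simp add: case_prod_unfold cong: conj_cong)
  also have "semialgebraic \<dots>"
    by (intro semialgebraic_conj semialgebraic_vimage semialgebraic_mult_triples
        semialgebraic_pd_triples semialgebraic_pd_rel polynomial_function_gram_triple
        polynomial_function_intros)
  finally show ?thesis .
qed

section \<open>Singular values as roots of the determinantal form\<close>

definition eval3 :: "'a::comm_ring_1 poly poly poly \<Rightarrow> 'a \<Rightarrow> 'a \<Rightarrow> 'a \<Rightarrow> 'a" where
  "eval3 F x y z = poly (map_poly (\<lambda>G. poly (map_poly (\<lambda>H. poly H x) G) y) F) z"

lemma poly_poly: "poly (poly P c) u = poly (map_poly (\<lambda>q. poly q u) P) (poly c u)"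
  by (induction P) (simp_all add: map_poly_pCons)

lemma poly_subst3: "poly (subst3 F a b c) u = eval3 F (poly a u) (poly b u) (poly c u)"
  unfolding subst3_def eval3_def
  by (simp add: poly_poly map_poly_map_poly o_def poly_pcompose)

lemma eval3_hom:
  shows "eval3 (F + G) x y z = eval3 F x y z + eval3 G x y z"
    and "eval3 (F * G) x y z = eval3 F x y z * eval3 G x y z"
    and "eval3 1 x y z = 1"
proof -
  note 1 = map_poly_hom[of "\<lambda>H. poly H x", OF poly_add poly_mult poly_1]
  have h2: "poly (map_poly (\<lambda>H. poly H x) (P + Q)) y = poly (map_poly (\<lambda>H. poly H x) P) y + poly (map_poly (\<lambda>H. poly H x) Q) y"
    "poly (map_poly (\<lambda>H. poly H x) (P * Q)) y = poly (map_poly (\<lambda>H. poly H x) P) y * poly (map_poly (\<lambda>H. poly H x) Q) y"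
    "poly (map_poly (\<lambda>H. poly H x) 1) y = 1" for P Q
    by (simp_all only: 1 poly_add poly_mult poly_1)
  note 2 = map_poly_hom[of "\<lambda>G. poly (map_poly (\<lambda>H. poly H x) G) y", OF h2]
  show "eval3 (F + G) x y z = eval3 F x y z + eval3 G x y z"
    "eval3 (F * G) x y z = eval3 F x y z * eval3 G x y z" "eval3 1 x y z = 1"
    unfolding eval3_def by (simp_all only: 2 poly_add poly_mult poly_1)
qed

lemma eval3_det_form_complex:
  fixes X Y Z :: "'n::finite cmat"
  shows "eval3 (det_form_complex (X, Y, Z)) x y z = det (mat x ** X + mat y ** Y + mat z ** Z)"
proof -
  have "eval3 (det_form_complex (X, Y, Z)) x y z
      = det (\<chi> i j. eval3 ([:[:[:0, 1:]:]:] * [:[:[:X $ i $ j:]:]:] +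
     [:[:0, 1:]:] * [:[:[:Y $ i $ j:]:]:] + [:0, 1:] * [:[:[:Z $ i $ j:]:]:]) x y z)"
    unfolding det_form_complex_def prod.case by (subst det_hom) (simp_all only: eval3_hom vec_lambda_beta)
  also have "(\<chi> i j. eval3 ([:[:[:0, 1:]:]:] * [:[:[:X $ i $ j:]:]:] +
     [:[:0, 1:]:] * [:[:[:Y $ i $ j:]:]:] + [:0, 1:] * [:[:[:Z $ i $ j:]:]:]) x y z)
     = mat x ** X + mat y ** Y + mat z ** Z"
    unfolding eval3_hom by (simp add: vec_eq_iff mat_mult_entry eval3_def map_poly_pCons)
  finally show ?thesis .
qed

lemma eval3_of_real:
  "eval3 (map_poly (map_poly (map_poly of_real)) F) (of_real x) (of_real y) (of_real z)
    = (of_real (eval3 F x y z) :: complex)"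
proof -
  have 1: "poly (map_poly of_real P) (of_real u) = (of_real (poly P u) :: complex)" for P u
    by (induction P) (simp_all add: map_poly_pCons)
  have 2: "poly (map_poly (\<lambda>H. poly H (of_real x)) (map_poly (map_poly of_real) G)) (of_real y)
      = (of_real (poly (map_poly (\<lambda>H. poly H x) G) y) :: complex)" for G
    by (simp add: map_poly_map_poly o_def 1 flip: 1)
  show ?thesis
    unfolding eval3_def by (simp add: map_poly_map_poly o_def 2 flip: 1)
qed

lemma eval3_smult: "eval3 (smult [:[:c:]:] F) x y z = c * eval3 F x y z"
proof -
  have "smult [:[:c:]:] F = [:[:[:c:]:]:] * F" by simp
  then show ?thesis
    by (simp only: eval3_hom) (simp add: eval3_def map_poly_pCons)
qed

lemma of_real_eval3_det_form:
  assumes "(X, Y, Z) \<in> pd_triples"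
  shows "of_real (eval3 (det_form (X, Y, Z)) x y z)
    = det (mat (of_real x) ** X + mat (of_real y) ** Y + mat (of_real z) ** Z)"
  by (simp only: eval3_of_real[symmetric] of_real_det_form[OF assms] eval3_det_form_complex)

lemma image_mset_sum_singletons: "image_mset f (\<Sum>i\<in>I. {#g i#}) = (\<Sum>i\<in>I. {#f (g i)#})"
  by (induction I rule: infinite_finite_induct) simp_all

text \<open>
  It suffices to compare values at real points \<open>u\<close>, because the characteristic polynomial of the Gram
  matrix splits into real linear factors, so that complex and real roots with multiplicity agree.
\<close>
lemma singular_values_eq_proots:
  fixes A :: "'n::finite cmat" and r :: "real poly"
  assumes "k \<noteq> 0"
    and r: "\<And>u. of_real (poly r u) = of_real k * det (mat (of_real u) - ctranspose A ** A)"
  shows "singular_values A = image_mset sqrt (proots r)"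
proof -
  have "ctranspose (ctranspose A ** A) = ctranspose A ** A" by (simp add: ctranspose_mult)
  then obtain U d where U: "unitary U" and A: "ctranspose A ** A = U ** diag d ** ctranspose U"
    by (rule spectral_theorem)
  have char: "char_poly_mat (ctranspose A ** A) = (\<Prod>i\<in>UNIV. [:- of_real (d i), 1:])"
    unfolding A by (rule char_poly_mat_spectral[OF U])
  have "poly r u = poly (smult k (\<Prod>i\<in>UNIV. [:- d i, 1:])) u" for u
  proof -
    have "complex_of_real (poly r u) = of_real k * (\<Prod>i\<in>UNIV. of_real u - of_real (d i))"
      unfolding r poly_char_poly_mat[symmetric] char by (simp add: poly_prod)
    also have "\<dots> = of_real (poly (smult k (\<Prod>i\<in>UNIV. [:- d i, 1:])) u)"
      by (simp add: poly_prod)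
    finally show ?thesis by (simp only: of_real_eq_iff)
  qed
  then have "r = smult k (\<Prod>i\<in>UNIV. [:- d i, 1:])"
    by (simp only: poly_eq_poly_eq_iff[symmetric] fun_eq_iff) blast
  then have "proots r = (\<Sum>i\<in>UNIV. {#d i#})"
    using assms(1) by (simp add: proots_prod)
  moreover have "eigenvalues (ctranspose A ** A) = (\<Sum>i\<in>UNIV. {#complex_of_real (d i)#})"
    unfolding eigenvalues_def char by (subst proots_prod) simp_all
  ultimately show ?thesis
    by (simp add: singular_values_def image_mset_sum_singletons)
qed

lemma det_ctranspose_mult: "det (ctranspose M) * det M = of_real ((cmod (det M))\<^sup>2)"
  for M :: "'n::finite cmat"
proof -
  have "cnj (det (transpose M)) = det (ctranspose M)"
    by (subst det_hom) (simp_all add: ctranspose_def transpose_def)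
  then show ?thesis by (simp add: complex_norm_square mult.commute del: of_real_power)
qed

lemma det_mat_congruence:
  fixes M N :: "'n::finite cmat"
  shows "det (mat u ** (ctranspose M ** M) - ctranspose M ** N ** M)
    = of_real ((cmod (det M))\<^sup>2) * det (mat u - N)"
proof -
  have "mat u ** (ctranspose M ** M) = ctranspose M ** mat u ** M"
    by (metis mat_mult_commute matrix_mul_assoc)
  then have "mat u ** (ctranspose M ** M) - ctranspose M ** N ** M = ctranspose M ** (mat u - N) ** M"
    by (simp add: matrix_diff_ldistrib matrix_diff_rdistrib)
  then show ?thesis by (simp add: det_mul det_ctranspose_mult[symmetric] del: of_real_power)
qed

text \<open>
  With \<open>X = A\<^sup>*A\<close>, \<open>Y = 1\<close> and \<open>Z = (CA)\<^sup>*(CA)\<close>, the three restrictions are \<open>det (u - A\<^sup>*A)\<close>,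
  \<open>det (uZ - 1)\<close> and \<open>det (uX - Z)\<close>. The last two are congruent to \<open>u - B\<^sup>*B\<close> and \<open>u - C\<^sup>*C\<close> by \<open>CA\<close>, the
  inverse of \<open>B\<close>, and by \<open>A\<close>.
\<close>
lemma singular_values_det_form:
  fixes A B C :: "'n::finite cmat"
  assumes T: "(A, B, C) \<in> mult_triples"
    and F: "F = smult [:[:c:]:] (det_form (gram_triple (A, B, C)))" "c \<noteq> 0"
  shows "singular_values A = image_mset sqrt (proots (subst3 F (-1) [:0, 1:] 0))"
    and "singular_values B = image_mset sqrt (proots (subst3 F 0 (-1) [:0, 1:]))"
    and "singular_values C = image_mset sqrt (proots (subst3 F [:0, 1:] 0 (-1)))"
proof -
  have inv: "invertible A" "invertible B" "invertible C" and ABC: "A ** B ** C = mat 1"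
    using T by (auto simp: mult_triples_def)
  define X Z where "X = ctranspose A ** A" and "Z = ctranspose (C ** A) ** (C ** A)"
  have gram: "gram_triple (A, B, C) = (X, mat 1, Z)" by (simp add: gram_triple_def X_def Z_def)
  then have pd: "(X, mat 1, Z) \<in> pd_triples" using gram_triple_pd[OF T] by simp
  have F_eval: "of_real (eval3 F x y z)
      = of_real c * det (mat (of_real x) ** X + mat (of_real y) + mat (of_real z) ** Z)" for x y z
    unfolding F gram eval3_smult of_real_mult of_real_eval3_det_form[OF pd] by simp
  have m: "- mat 1 ** M = - M" "mat 0 ** M = 0" "mat (-1) = - (mat 1 :: 'n cmat)" "mat 0 = (0 :: 'n cmat)" for M :: "'n cmat"
    by (simp_all add: matrix_mult_minus vec_eq_iff mat_mult_entry) (simp_all add: mat_def)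
  show "singular_values A = image_mset sqrt (proots (subst3 F (-1) [:0, 1:] 0))"
  proof (rule singular_values_eq_proots[OF F(2)])
    fix u
    show "of_real (poly (subst3 F (-1) [:0, 1:] 0) u)
      = of_real c * det (mat (of_real u) - ctranspose A ** A)"
      by (simp add: poly_subst3 F_eval m X_def)
  qed
  have "c * (cmod (det (C ** A)))\<^sup>2 \<noteq> 0"
    using F(2) inv by (simp add: det_mul invertible_det_nz)
  then show "singular_values B = image_mset sqrt (proots (subst3 F 0 (-1) [:0, 1:]))"
  proof (rule singular_values_eq_proots)
    fix u
    have "(B ** C) ** A = mat 1" using ABC by (metis matrix_left_right_inverse matrix_mul_assoc)
    then have BCA: "B ** (C ** A) = mat 1" by (simp add: matrix_mul_assoc)
    have "ctranspose (C ** A) ** (ctranspose B ** B) ** (C ** A)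
        = ctranspose (B ** (C ** A)) ** (B ** (C ** A))"
      by (simp only: ctranspose_mult matrix_mul_assoc)
    then have "mat 1 = ctranspose (C ** A) ** (ctranspose B ** B) ** (C ** A)" by (simp add: BCA)
    then have "det (mat (of_real u) ** Z - mat 1)
        = of_real ((cmod (det (C ** A)))\<^sup>2) * det (mat (of_real u) - ctranspose B ** B)"
      unfolding Z_def using det_mat_congruence[of "of_real u" "C ** A" "ctranspose B ** B"] by simp
    then show "of_real (poly (subst3 F 0 (-1) [:0, 1:]) u)
      = of_real (c * (cmod (det (C ** A)))\<^sup>2) * det (mat (of_real u) - ctranspose B ** B)"
      by (simp add: poly_subst3 F_eval m)
  qed
  have "c * (cmod (det A))\<^sup>2 \<noteq> 0" using F(2) inv by (simp add: invertible_det_nz)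
  then show "singular_values C = image_mset sqrt (proots (subst3 F [:0, 1:] 0 (-1)))"
  proof (rule singular_values_eq_proots)
    fix u
    have "Z = ctranspose A ** (ctranspose C ** C) ** A"
      by (simp add: Z_def ctranspose_mult matrix_mul_assoc)
    then have "det (mat (of_real u) ** X - Z)
        = of_real ((cmod (det A))\<^sup>2) * det (mat (of_real u) - ctranspose C ** C)"
      unfolding X_def using det_mat_congruence[of "of_real u" A "ctranspose C ** C"] by simp
    then show "of_real (poly (subst3 F [:0, 1:] 0 (-1)) u)
      = of_real (c * (cmod (det A))\<^sup>2) * det (mat (of_real u) - ctranspose C ** C)"
      by (simp add: poly_subst3 F_eval m)
  qed
qed

theorem proposition7:
  shows "\<exists>\<beta> :: ('n::finite cmat \<times> 'n cmat \<times> 'n cmat) set \<Rightarrow> ('n cmat \<times> 'n cmat \<times> 'n cmat) set.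
    semialgebraic_quotient_iso mult_triples mult_rel pd_triples pd_rel \<beta> \<and>
    (\<forall>A B C F. (A, B, C) \<in> mult_triples \<longrightarrow> F \<in> delta (\<beta> (mult_rel `` {(A, B, C)})) \<longrightarrow>
       singular_values A = image_mset sqrt (proots (subst3 F (-1) [:0, 1:] 0)) \<and>
       singular_values B = image_mset sqrt (proots (subst3 F 0 (-1) [:0, 1:])) \<and>
       singular_values C = image_mset sqrt (proots (subst3 F [:0, 1:] 0 (-1))))"
proof (intro exI[of _ beta] conjI allI impI)
  show "semialgebraic_quotient_iso mult_triples mult_rel
      (pd_triples :: ('n cmat \<times> 'n cmat \<times> 'n cmat) set) pd_rel beta"
    unfolding semialgebraic_quotient_iso_def
    by (intro conjI semialgebraic_mult_triples equiv_mult_rel semialgebraic_mult_rel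
        semialgebraic_pd_triples equiv_pd_rel semialgebraic_pd_rel homeomorphic_map_beta
        semialgebraic_graph_beta)
  fix A B C :: "'n cmat" and F
  assume T: "(A, B, C) \<in> mult_triples" and "F \<in> delta (beta (mult_rel `` {(A, B, C)}))"
  then obtain c where F: "F = smult [:[:c:]:] (det_form (gram_triple (A, B, C)))" "c \<noteq> 0"
    unfolding beta_class[OF T] delta_class[OF gram_triple_pd[OF T]] by blast
  show "singular_values A = image_mset sqrt (proots (subst3 F (-1) [:0, 1:] 0))"
    "singular_values B = image_mset sqrt (proots (subst3 F 0 (-1) [:0, 1:]))"
    "singular_values C = image_mset sqrt (proots (subst3 F [:0, 1:] 0 (-1)))"
    using singular_values_det_form[OF T F] by blast+
qed

end
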